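(* Let $J=2$, $N\to\infty$, and fix the sparsity rate $S_C$ of the common component and the innovation sparsity rates $S_1=S_2=S_I$, in the stochastic JSM-1 signal model described in the context. If the measurement rates $R_1,R_2$ satisfy $$R_j > c'(2S_I-S_I^2),\qquad j=1,2,$$ $$R_1+R_2 > c'(2S_I-S_I^2)+c'\big(S_C+2S_I-2S_CS_I-S_I^2+S_CS_I^2\big),$$ then one can design measurement matrices $\Phi_1$ ($M_1\times N$) and $\Phi_2$ ($M_2\times N$) with random Gaussian entries, with $M_j/N\to R_j$, and a recovery algorithm based on $\ell_1$-norm minimization which, from $\Phi_1,\Phi_2$ and $y_1=\Phi_1x_1$, $y_2=\Phi_2x_2$, recovers $x_1$ and $x_2$ with probability approaching one as $N\to\infty$. Furthermore, as $S_I\to 0$ the sum measurement rate (the right-hand side of the second condition) approaches $c'(S_C)$.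
   Context: Stochastic JSM-1 model with $J=2$: $x_j=z_C+z_j\in\mathbb{R}^N$, $j=1,2$. Independently for each $n\in\{1,\dots,N\}$ and independently across the components, $z_C(n)$ is nonzero with probability $S_C$ and $z_j(n)$ is nonzero with probability $S_j$; the values of the nonzero entries are i.i.d. (nondegenerate zero-mean) Gaussian. The measurement rates are $R_j=\lim_{N\to\infty}M_j/N$. The measurement matrices are drawn independently of the signals; their joint law may be designed ($\Phi_1$ and $\Phi_2$ need not be independent of each other). $\ell_1$-norm minimization for measurements $y=\Phi v$ of an unknown $v$ means solving $\min\|v'\|_1$ subject to $y=\Phi v'$. The overmeasuring factor $c(S)>1$ (Donoho–Tanner) is the threshold function, with $c(S)=O(\log(1/S))$, such that for a $K$-sparse signal of length $N$ with $K=SN$ and for every $\epsilon>0$: the probability of recovering the signal via $\ell_1$-norm minimization from $(c(S)+\epsilon)K$ random i.i.d. Gaussian projections converges to one as $N\to\infty$, and from $(c(S)-\epsilon)K$ such projections it converges to zero. Define $c'(S):=S\cdot c(S)$. The function $c'$ is known to be continuous and concave, with $c'(S)\to0$ as $S\to0$. *)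

theory Defs
  imports "HOL-Probability.Probability" "HOL-Library.Landau_Symbols"
begin

section \<open>Measurements and \<open>\<ell>\<^sub>1\<close>-norm minimization\<close>

text \<open>
  A vector of length \<open>n\<close> is an element of \<open>{..<n} \<rightarrow>\<^sub>E UNIV\<close>, so that vectors are equal iff their
  entries below \<open>n\<close> agree; only the entries with indices in \<open>{..<m} \<times> {..<n}\<close> of an \<open>m \<times> n\<close>
  matrix matter. Dimensions are natural numbers because they tend to infinity below.
\<close>

type_synonym rvec = "nat \<Rightarrow> real"
type_synonym rmat = "nat \<times> nat \<Rightarrow> real"

definition apply_mat :: "nat \<Rightarrow> nat \<Rightarrow> rmat \<Rightarrow> rvec \<Rightarrow> rvec" where
  "apply_mat m n A v = (\<lambda>i\<in>{..<m}. \<Sum>k<n. A (i, k) * v k)"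

definition l1_norm :: "nat \<Rightarrow> rvec \<Rightarrow> real" where
  "l1_norm n v = (\<Sum>k<n. \<bar>v k\<bar>)"

definition l1_solutions :: "nat \<Rightarrow> nat \<Rightarrow> rmat \<Rightarrow> rvec \<Rightarrow> rvec set" where
  "l1_solutions m n A y =
     {v \<in> {..<n} \<rightarrow>\<^sub>E UNIV. apply_mat m n A v = y \<and>
        (\<forall>v' \<in> {..<n} \<rightarrow>\<^sub>E UNIV. apply_mat m n A v' = y \<longrightarrow> l1_norm n v \<le> l1_norm n v')}"

definition l1_recovers :: "nat \<Rightarrow> nat \<Rightarrow> rmat \<Rightarrow> rvec \<Rightarrow> bool" where
  "l1_recovers m n A v \<longleftrightarrow> l1_solutions m n A (apply_mat m n A v) = {v}"


section \<open>The overmeasuring factor\<close>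

definition gaussian_matrix :: "nat \<Rightarrow> nat \<Rightarrow> rmat measure" where
  "gaussian_matrix m n = (\<Pi>\<^sub>M i\<in>{..<m} \<times> {..<n}. std_normal_distribution)"

definition l1_recovery_prob :: "nat \<Rightarrow> nat \<Rightarrow> rvec \<Rightarrow> real" where
  "l1_recovery_prob m n v =
     measure (gaussian_matrix m n) {A \<in> space (gaussian_matrix m n). l1_recovers m n A v}"

definition sparse_vectors :: "nat \<Rightarrow> nat \<Rightarrow> rvec set" where
  "sparse_vectors K n = {v \<in> {..<n} \<rightarrow>\<^sub>E UNIV. card {k \<in> {..<n}. v k \<noteq> 0} = K}"

text \<open>
  The signals are sparse with exactly \<open>K = \<lfloor>S N\<rfloor>\<close> nonzero entries: sparser signals, such as \<open>0\<close>,
  need fewer measurements, so the failure half of the threshold would not hold for them.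
  The signal is fixed before the matrix is drawn.
\<close>

definition overmeasuring_factor :: "(real \<Rightarrow> real) \<Rightarrow> bool" where
  "overmeasuring_factor c \<longleftrightarrow>
     (\<forall>S\<in>{0<..<1}. c S > 1) \<and>
     c \<in> O[at_right 0](\<lambda>S. ln (1 / S)) \<and>
     (\<forall>S\<in>{0<..<1}. \<forall>\<epsilon>>0. \<forall>v.
        (\<forall>N. v N \<in> sparse_vectors (nat \<lfloor>S * real N\<rfloor>) N) \<longrightarrow>
        (\<lambda>N. l1_recovery_prob (nat \<lceil>(c S + \<epsilon>) * real (nat \<lfloor>S * real N\<rfloor>)\<rceil>) N (v N))
          \<longlonglongrightarrow> 1 \<and>
        (\<lambda>N. l1_recovery_prob (nat \<lfloor>(c S - \<epsilon>) * real (nat \<lfloor>S * real N\<rfloor>)\<rfloor>) N (v N))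
          \<longlonglongrightarrow> 0)"

definition overmeasuring_rate :: "(real \<Rightarrow> real) \<Rightarrow> real \<Rightarrow> real" where
  "overmeasuring_rate c S = S * c S"


section \<open>The stochastic JSM-1 model with two signals\<close>

definition sparse_gaussian :: "real \<Rightarrow> real \<Rightarrow> real measure" where
  "sparse_gaussian S \<sigma> =
     distr (measure_pmf (bernoulli_pmf S) \<Otimes>\<^sub>M density lborel (normal_density 0 \<sigma>)) borel
       (\<lambda>(b, g). if b then g else 0)"

text \<open>The joint law of \<open>(z\<^sub>C, (z\<^sub>j)\<^sub>j)\<close>, where \<open>j\<close> ranges over \<open>{1, 2}\<close>.\<close>

definition jsm1 :: "real \<Rightarrow> (nat \<Rightarrow> real) \<Rightarrow> real \<Rightarrow> nat \<Rightarrow> (rvec \<times> (nat \<Rightarrow> rvec)) measure" where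
  "jsm1 S\<^sub>C S \<sigma> N =
     (\<Pi>\<^sub>M n\<in>{..<N}. sparse_gaussian S\<^sub>C \<sigma>) \<Otimes>\<^sub>M
     (\<Pi>\<^sub>M j\<in>{1, 2}. \<Pi>\<^sub>M n\<in>{..<N}. sparse_gaussian (S j) \<sigma>)"

definition jsm1_signal :: "nat \<Rightarrow> rvec \<times> (nat \<Rightarrow> rvec) \<Rightarrow> nat \<Rightarrow> rvec" where
  "jsm1_signal N z j = (\<lambda>n\<in>{..<N}. fst z n + snd z j n)"

text \<open>
  A joint law of two matrices, of sizes \<open>M 1 \<times> N\<close> and \<open>M 2 \<times> N\<close>, each of which has i.i.d.
  standard Gaussian entries. The two matrices may depend on each other in any way.
\<close>

definition gaussian_design :: "nat \<Rightarrow> (nat \<Rightarrow> nat) \<Rightarrow> (nat \<Rightarrow> rmat) measure \<Rightarrow> bool" where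
  "gaussian_design N M D \<longleftrightarrow>
     sets D = sets (\<Pi>\<^sub>M j\<in>{1, 2}. gaussian_matrix (M j) N) \<and>
     (\<forall>j\<in>{1, 2}.
        distr D (gaussian_matrix (M j) N) (\<lambda>\<Phi>. \<Phi> j) = gaussian_matrix (M j) N)"


section \<open>Recovery algorithms based on \<open>\<ell>\<^sub>1\<close>-norm minimization\<close>

text \<open>
  Such an algorithm solves finitely many \<open>\<ell>\<^sub>1\<close>-norm minimization problems
  \<open>min \<parallel>v\<parallel>\<^sub>1 s.t. A v = b\<close> one after the other, with solutions \<open>v\<^sub>0, v\<^sub>1, \<dots>\<close>, and apart
  from that only forms linear combinations with predetermined coefficients:
  each row of \<open>A\<close> combines rows of the measurement matrices, each entry of \<open>b\<close> combines
  measurements \<open>y\<^sub>j(i)\<close> and re-measured earlier solutions \<open>(\<Phi>\<^sub>j v\<^sub>s)(i)\<close>, and the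
  estimates of the signals combine the \<open>v\<^sub>s\<close>.
  In the coefficients below, \<open>s\<close> is the number of an earlier problem, \<open>k\<close> a row of the current
  problem, \<open>j \<in> {1, 2}\<close> a sensor and \<open>i\<close> one of the measurements of sensor \<open>j\<close>. The coefficients
  are fixed before the measurement matrices and the measurements are seen.
\<close>

record l1_step =
  num_rows :: nat
  matrix_coeff :: "nat \<Rightarrow> nat \<Rightarrow> nat \<Rightarrow> real"  \<comment> \<open>arguments \<open>k j i\<close>\<close>
  data_coeff :: "nat \<Rightarrow> nat \<Rightarrow> nat \<Rightarrow> real"  \<comment> \<open>arguments \<open>k j i\<close>\<close>
  feedback_coeff :: "nat \<Rightarrow> nat \<Rightarrow> nat \<Rightarrow> nat \<Rightarrow> real"  \<comment> \<open>arguments \<open>s k j i\<close>\<close>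

record l1_algorithm =
  steps :: "l1_step list"
  output_coeff :: "nat \<Rightarrow> nat \<Rightarrow> real"  \<comment> \<open>arguments \<open>j s\<close>\<close>

definition combine :: "(nat \<Rightarrow> nat) \<Rightarrow> (nat \<Rightarrow> nat \<Rightarrow> real) \<Rightarrow> (nat \<Rightarrow> nat \<Rightarrow> real) \<Rightarrow> real" where
  "combine M a y = (\<Sum>j\<in>{1, 2}. \<Sum>i<M j. a j i * y j i)"

definition step_matrix :: "(nat \<Rightarrow> nat) \<Rightarrow> l1_step \<Rightarrow> (nat \<Rightarrow> rmat) \<Rightarrow> rmat" where
  "step_matrix M st \<Phi> = (\<lambda>(k, n). combine M (matrix_coeff st k) (\<lambda>j i. \<Phi> j (i, n)))"

definition step_data ::
  "nat \<Rightarrow> (nat \<Rightarrow> nat) \<Rightarrow> l1_step \<Rightarrow> (nat \<Rightarrow> rmat) \<Rightarrow> (nat \<Rightarrow> rvec) \<Rightarrow> rvec list \<Rightarrow> rvec" where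
  "step_data N M st \<Phi> y vs =
     (\<lambda>k\<in>{..<num_rows st}.
        combine M (data_coeff st k) y +
        (\<Sum>s<length vs.
           combine M (feedback_coeff st s k) (\<lambda>j. apply_mat (M j) N (\<Phi> j) (vs ! s))))"

text \<open>
  Every minimization problem along the way is required to have a unique solution, so that the
  result does not depend on how ties between minimizers are broken.
\<close>

definition l1_algorithm_returns ::
  "nat \<Rightarrow> (nat \<Rightarrow> nat) \<Rightarrow> l1_algorithm \<Rightarrow> (nat \<Rightarrow> rmat) \<Rightarrow> (nat \<Rightarrow> rvec) \<Rightarrow> (nat \<Rightarrow> rvec) \<Rightarrow> bool"
where
  "l1_algorithm_returns N M alg \<Phi> y x \<longleftrightarrow>
     (\<exists>vs. length vs = length (steps alg) \<and>
        (\<forall>t<length vs.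
           l1_solutions (num_rows (steps alg ! t)) N (step_matrix M (steps alg ! t) \<Phi>)
             (step_data N M (steps alg ! t) \<Phi> y (take t vs)) = {vs ! t}) \<and>
        (\<forall>j\<in>{1, 2}. x j = (\<lambda>n\<in>{..<N}. \<Sum>t<length vs. output_coeff alg j t * (vs ! t) n)))"

definition recovery_event ::
  "nat \<Rightarrow> (nat \<Rightarrow> nat) \<Rightarrow> l1_algorithm \<Rightarrow> ((rvec \<times> (nat \<Rightarrow> rvec)) \<times> (nat \<Rightarrow> rmat)) set"
where
  "recovery_event N M alg =
     {(z, \<Phi>). l1_algorithm_returns N M alg \<Phi>
        (\<lambda>j. apply_mat (M j) N (\<Phi> j) (jsm1_signal N z j)) (jsm1_signal N z)}"

end

theory Submission
  imports Defs
begin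

text \<open>
  Let the two matrices share their first \<open>m\<close> rows. Subtracting the shared measurements gives \<open>m\<close>
  Gaussian measurements of \<open>x\<^sub>1 - x\<^sub>2 = z\<^sub>1 - z\<^sub>2\<close>, whose sparsity rate is at most
  \<open>1 - (1 - S\<^sub>I)\<^sup>2\<close>, so \<open>m \<approx> N c'(2S\<^sub>I - S\<^sub>I\<^sup>2)\<close> rows recover it. Once it is known, the remaining
  \<open>M\<^sub>2 - m\<close> measurements of \<open>x\<^sub>2\<close> become measurements of \<open>x\<^sub>1\<close>, which is thus seen through
  \<open>M\<^sub>1 + M\<^sub>2 - m\<close> independent Gaussian rows; its support lies in the union of the supports of
  \<open>z\<^sub>C, z\<^sub>1, z\<^sub>2\<close>, of rate \<open>1 - (1 - S\<^sub>C)(1 - S\<^sub>I)\<^sup>2\<close>.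

  The threshold concerns fixed signals with exactly \<open>\<lfloor>S N\<rfloor>\<close> nonzero entries, whereas the
  signals here have random supports. By the null space characterization, success depends only
  on the signs of the signal and is inherited by restrictions of the signal to fewer entries, so it
  suffices to bound the support size, which Chebyshev's inequality does with high probability
  for any rate slightly above the mean; continuity of \<open>c'\<close> pays for the slack.
\<close>

section \<open>Null space characterization of recovery\<close>

text \<open>For \<open>s\<close> the sign pattern of a vector, this is the one-sided directional
  derivative of the l1 norm along \<open>h\<close>; the weight of \<open>\<bar>h k\<bar>\<close>
  selects the entries off the support. In this form it is jointly continuous in \<open>s\<close> and
  \<open>h\<close>.\<close>

definition l1_slope :: "nat \<Rightarrow> rvec \<Rightarrow> rvec \<Rightarrow> real" where
  "l1_slope n s h = (\<Sum>k<n. s k * h k + (1 - \<bar>s k\<bar>) * \<bar>h k\<bar>)"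

text \<open>Convexity: the norm lies above its one-sided linearization, entry by entry.\<close>

lemma l1_slope_le:
  fixes v h :: rvec
  shows "l1_norm n v + l1_slope n (\<lambda>k. sgn (v k)) h \<le> l1_norm n (\<lambda>k. v k + h k)"
  unfolding l1_norm_def l1_slope_def sum.distrib[symmetric]
  by (intro sum_mono) (auto simp: sgn_if)

text \<open>A perturbation that flips no sign on the support changes each absolute value there
  linearly; off the support it contributes exactly \<open>\<bar>h k\<bar>\<close>.\<close>

lemma l1_slope_eq:
  fixes v h :: rvec
  assumes "\<And>k. k < n \<Longrightarrow> v k \<noteq> 0 \<Longrightarrow> \<bar>h k\<bar> \<le> \<bar>v k\<bar>"
  shows "l1_norm n (\<lambda>k. v k + h k) = l1_norm n v + l1_slope n (\<lambda>k. sgn (v k)) h"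
proof -
  have "\<bar>v k + h k\<bar> = \<bar>v k\<bar> + (sgn (v k) * h k + (1 - \<bar>sgn (v k)\<bar>) * \<bar>h k\<bar>)" if "k < n" for k
    using assms[OF that] by (auto simp: sgn_if)
  then show ?thesis by (simp add: l1_norm_def l1_slope_def flip: sum.distrib)
qed

lemma l1_slope_scale: "t \<ge> 0 \<Longrightarrow> l1_slope n s (\<lambda>k. t * h k) = t * l1_slope n s h"
  by (simp add: l1_slope_def sum_distrib_left abs_mult algebra_simps)

lemma apply_mat_eq_iff:
  "apply_mat m n A v = apply_mat m n A w \<longleftrightarrow> (\<forall>i<m. (\<Sum>k<n. A (i, k) * (w k - v k)) = 0)"
proof -
  have "apply_mat m n A v = apply_mat m n A w \<longleftrightarrow>
      (\<forall>i<m. (\<Sum>k<n. A (i, k) * v k) = (\<Sum>k<n. A (i, k) * w k))"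
    by (auto simp: apply_mat_def restrict_def fun_eq_iff)
  then show ?thesis
    unfolding right_diff_distrib sum_subtractf by auto
qed

lemma l1_norm_cong: "(\<And>k. k < n \<Longrightarrow> v k = w k) \<Longrightarrow> l1_norm n v = l1_norm n w"
  by (simp add: l1_norm_def)

text \<open>By convexity the minimizer is unique iff the one-sided directional derivative of the
  norm is positive along every nonzero kernel direction; this depends on \<open>v\<close> only through its signs.\<close>

lemma l1_recovers_iff:
  fixes A :: rmat and v :: rvec
  assumes v: "v \<in> {..<n} \<rightarrow>\<^sub>E UNIV"
  shows "l1_recovers m n A v \<longleftrightarrow>
    (\<forall>h. (\<forall>i<m. (\<Sum>k<n. A (i, k) * h k) = 0) \<longrightarrow> (\<exists>k<n. h k \<noteq> 0) \<longrightarrow>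
      0 < l1_slope n (\<lambda>k. sgn (v k)) h)"
proof (intro iffI allI impI)
  fix h :: rvec
  assume rec: "l1_recovers m n A v" and ker: "\<forall>i<m. (\<Sum>k<n. A (i, k) * h k) = 0"
    and h: "\<exists>k<n. h k \<noteq> 0"
  show "0 < l1_slope n (\<lambda>k. sgn (v k)) h"
  proof (rule ccontr)
    assume le: "\<not> 0 < l1_slope n (\<lambda>k. sgn (v k)) h"
    \<comment> \<open>This step length keeps \<open>t * h\<close> below \<open>v\<close> on the
      support, so no sign flips. The \<open>+ 1\<close> avoids a zero denominator, and the inserted
      \<open>1\<close> keeps the set nonempty when \<open>v\<close> vanishes.\<close>
    define t where "t = Min (insert 1 ((\<lambda>k. \<bar>v k\<bar> / (\<bar>h k\<bar> + 1)) ` {k. k < n \<and> v k \<noteq> 0}))"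
    have t: "t > 0" unfolding t_def by (subst Min_gr_iff) (auto intro!: divide_pos_pos)
    have small: "\<bar>t * h k\<bar> \<le> \<bar>v k\<bar>" if "k < n" "v k \<noteq> 0" for k
    proof -
      have "t \<le> \<bar>v k\<bar> / (\<bar>h k\<bar> + 1)" unfolding t_def using that by (intro Min_le) auto
      then have "t * (\<bar>h k\<bar> + 1) \<le> \<bar>v k\<bar>" by (simp add: pos_le_divide_eq add_nonneg_pos)
      moreover have "t * \<bar>h k\<bar> \<le> t * (\<bar>h k\<bar> + 1)" using t by (intro mult_left_mono) auto
      ultimately have "t * \<bar>h k\<bar> \<le> \<bar>v k\<bar>" by linarith
      then show ?thesis using t by (simp add: abs_mult)
    qed
    \<comment> \<open>Moving along a kernel direction of nonpositive slope stays feasible without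
      raising the norm, so \<open>w\<close> is a second minimizer.\<close>
    define w where "w = (\<lambda>k\<in>{..<n}. v k + t * h k)"
    have "l1_norm n w = l1_norm n (\<lambda>k. v k + t * h k)" by (rule l1_norm_cong) (simp add: w_def)
    also have "\<dots> = l1_norm n v + t * l1_slope n (\<lambda>k. sgn (v k)) h"
      using l1_slope_eq[of n v "\<lambda>k. t * h k"] small t by (simp add: l1_slope_scale)
    also have "\<dots> \<le> l1_norm n v" using le t by (simp add: mult_nonneg_nonpos)
    finally have wle: "l1_norm n w \<le> l1_norm n v" .
    have mw: "apply_mat m n A v = apply_mat m n A w"
      unfolding apply_mat_eq_iff using ker
      by (simp add: w_def mult.left_commute flip: sum_distrib_left)
    have "v \<in> l1_solutions m n A (apply_mat m n A v)" using rec by (simp add: l1_recovers_def)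
    then have "w \<in> l1_solutions m n A (apply_mat m n A v)"
      using wle mw by (force simp: l1_solutions_def w_def)
    then have "w = v" using rec by (simp add: l1_recovers_def)
    moreover obtain k where "k < n" "h k \<noteq> 0" using h by blast
    ultimately show False using t by (auto simp: w_def dest!: fun_cong[where x = k])
  qed
next
  assume *: "\<forall>h. (\<forall>i<m. (\<Sum>k<n. A (i, k) * h k) = 0) \<longrightarrow> (\<exists>k<n. h k \<noteq> 0) \<longrightarrow>
      0 < l1_slope n (\<lambda>k. sgn (v k)) h"
  have less: "l1_norm n v < l1_norm n w"
    if w: "w \<in> {..<n} \<rightarrow>\<^sub>E UNIV" "apply_mat m n A w = apply_mat m n A v" "w \<noteq> v" for w
  proof -
    have "\<exists>k<n. w k - v k \<noteq> 0"
    proof (rule ccontr)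
      assume "\<not> ?thesis"
      then have "w = v" using v w(1) by (intro PiE_ext[of _ "{..<n}"]) auto
      with w show False by simp
    qed
    then have "0 < l1_slope n (\<lambda>k. sgn (v k)) (\<lambda>k. w k - v k)"
      using * w(2) apply_mat_eq_iff[of m n A v w] by simp
    with l1_slope_le[of n v "\<lambda>k. w k - v k"] show ?thesis by simp
  qed
  have "v \<in> l1_solutions m n A (apply_mat m n A v)"
    unfolding l1_solutions_def using v less by (auto intro: less_imp_le)
  moreover have "w = v" if "w \<in> l1_solutions m n A (apply_mat m n A v)" for w
    using less[of w] that v by (force simp: l1_solutions_def)
  ultimately show "l1_recovers m n A v" by (auto simp: l1_recovers_def)
qed

section \<open>Monotonicity in the rows and in the support\<close>

lemma l1_recovers_more_rows:
  assumes "v \<in> {..<n} \<rightarrow>\<^sub>E UNIV" "m \<le> m'" "l1_recovers m n A v"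
  shows "l1_recovers m' n A v"
  using assms by (simp add: l1_recovers_iff)

lemma l1_recovers_cong:
  assumes "v \<in> {..<n} \<rightarrow>\<^sub>E UNIV" "\<And>i k. i < m \<Longrightarrow> k < n \<Longrightarrow> A (i, k) = B (i, k)"
  shows "l1_recovers m n A v \<longleftrightarrow> l1_recovers m n B v"
  using assms by (simp add: l1_recovers_iff)

text \<open>Where an entry of \<open>w\<close> is dropped, its slope term
  \<open>sgn (w k) * h k\<close> is replaced by \<open>\<bar>h k\<bar>\<close>, which is no smaller.
  Positivity of the slope on the kernel therefore survives.\<close>

lemma l1_recovers_sparser:
  assumes v: "v \<in> {..<n} \<rightarrow>\<^sub>E UNIV" and w: "w \<in> {..<n} \<rightarrow>\<^sub>E UNIV"
    and eq: "\<And>k. k < n \<Longrightarrow> v k \<noteq> 0 \<Longrightarrow> w k = v k" and rec: "l1_recovers m n A w"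
  shows "l1_recovers m n A v"
proof -
  have "l1_slope n (\<lambda>k. sgn (w k)) h \<le> l1_slope n (\<lambda>k. sgn (v k)) h" for h
    unfolding l1_slope_def
  proof (intro sum_mono)
    fix k assume "k \<in> {..<n}"
    then show "sgn (w k) * h k + (1 - \<bar>sgn (w k)\<bar>) * \<bar>h k\<bar> \<le> sgn (v k) * h k + (1 - \<bar>sgn (v k)\<bar>) * \<bar>h k\<bar>"
      using eq[of k] by (cases "v k = 0") (auto simp: sgn_if)
  qed
  with rec show ?thesis by (simp add: l1_recovers_iff v w) (meson less_le_trans)
qed

text \<open>Bridges the gap between supports of size at most \<open>K\<close>, as random signals
  have, and the exact size in \<open>sparse_vectors\<close>: missing positions are filled with
  ones.\<close>

lemma sparse_vectors_extend:
  assumes v: "v \<in> {..<n} \<rightarrow>\<^sub>E UNIV" and "card {k \<in> {..<n}. v k \<noteq> 0} \<le> K" "K \<le> n"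
  shows "\<exists>w\<in>sparse_vectors K n. \<forall>k<n. v k \<noteq> 0 \<longrightarrow> w k = v k"
proof -
  obtain B where B: "{k \<in> {..<n}. v k \<noteq> 0} \<subseteq> B" "B \<subseteq> {..<n}" "card B = K"
    using exists_subset_between[of "{k \<in> {..<n}. v k \<noteq> 0}" K "{..<n}"] assms by auto
  define w where "w = (\<lambda>k\<in>{..<n}. if v k \<noteq> 0 then v k else if k \<in> B then 1 else 0)"
  have "{k \<in> {..<n}. w k \<noteq> 0} = B" using B by (auto simp: w_def)
  then have "w \<in> sparse_vectors K n" using B by (simp add: sparse_vectors_def w_def)
  moreover have "\<forall>k<n. v k \<noteq> 0 \<longrightarrow> w k = v k" by (simp add: w_def)
  ultimately show ?thesis by blast
qed

lemma sparse_vectors_nonempty: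
  assumes "K \<le> n"
  shows "\<exists>v. v \<in> sparse_vectors K n"
proof -
  have "{k \<in> {..<n}. (\<lambda>k\<in>{..<n}. if k < K then 1 else 0 :: real) k \<noteq> 0} = {..<K}"
    using assms by auto
  then have "(\<lambda>k\<in>{..<n}. if k < K then 1 else 0 :: real) \<in> sparse_vectors K n"
    unfolding sparse_vectors_def by simp
  then show ?thesis by (rule exI[where P = "\<lambda>v. v \<in> sparse_vectors K n"])
qed

lemma nat_floor_mult_le:
  assumes "s \<le> 1"
  shows "nat \<lfloor>s * real N\<rfloor> \<le> N"
proof -
  have "s * real N \<le> 1 * real N" using assms by (rule mult_right_mono) simp
  then show ?thesis by linarith
qed

section \<open>Measurability of recovery\<close>

text \<open>Failure of recovery is the projection along a compact set of a closed set of triples of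
  a normalized kernel direction, a matrix and a sign vector.\<close>

lemma closed_kernel_condition:
  "closed {(A :: rmat, s :: rvec). \<exists>h\<in>PiE UNIV (\<lambda>_. {-1..1}). (\<forall>i<m. (\<Sum>k<n. A (i, k) * h k) = 0) \<and>
     (\<Sum>k<n. \<bar>h k\<bar>) = 1 \<and> l1_slope n s h \<le> 0}" (is "closed ?P")
proof -
  let ?K = "PiE UNIV (\<lambda>_. {-1..1}) :: rvec set"
  let ?C = "{p :: rvec \<times> rmat \<times> rvec. (\<forall>i<m. (\<Sum>k<n. fst (snd p) (i, k) * fst p k) = 0) \<and>
     (\<Sum>k<n. \<bar>fst p k\<bar>) = 1 \<and> l1_slope n (snd (snd p)) (fst p) \<le> 0}"
  have coord[continuous_intros]: "continuous_on UNIV (\<lambda>p. f p k)"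
    if "continuous_on UNIV f" for f :: "'z::topological_space \<Rightarrow> ('i \<Rightarrow> real)" and k
    using that by (rule continuous_on_product_then_coordinatewise)
  have C: "closed ?C"
    unfolding l1_slope_def
    by (intro closed_Collect_conj closed_Collect_all closed_Collect_imp open_Collect_const
        closed_Collect_eq closed_Collect_le continuous_intros)
  \<comment> \<open>Every coordinate of \<open>h\<close>, including those from \<open>n\<close> on,
    is confined to an interval, so the cube is compact by Tychonoff and projecting it away is a
    closed map.\<close>
  have "compactin euclidean ?K"
    using compactin_PiE[of "\<lambda>_. euclidean" UNIV "\<lambda>_. {-1..1::real}"]
    by (simp add: euclidean_product_topology)
  then have K: "compact_space (top_of_set ?K)" by (simp add: compact_space_subtopology)
  have "closed_map (prod_topology (top_of_set ?K) euclidean) euclidean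
     (snd :: rvec \<times> rmat \<times> rvec \<Rightarrow> _)"
    by (rule Abstract_Topological_Spaces.closed_map_snd[OF K])
  moreover have "closedin (prod_topology (top_of_set ?K) euclidean) (?C \<inter> (?K \<times> UNIV))"
  proof -
    have "prod_topology (top_of_set ?K) euclidean = (top_of_set (?K \<times> UNIV) :: (rvec \<times> rmat \<times> rvec) topology)"
      using subtopology_Times[of euclidean euclidean ?K "UNIV :: (rmat \<times> rvec) set"]
      by simp
    then show ?thesis using C by (auto simp: closedin_closed)
  qed
  ultimately have "closed (snd ` (?C \<inter> (?K \<times> UNIV)))"
    by (auto simp: closed_map_def)
  moreover have "snd ` (?C \<inter> (?K \<times> UNIV)) = ?P"
  proof (intro set_eqI iffI)
    fix q assume "q \<in> snd ` (?C \<inter> (?K \<times> UNIV))"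
    then obtain h where "(h, q) \<in> ?C" "h \<in> ?K" by auto
    then show "q \<in> ?P" by (cases q) auto
  next
    fix q assume "q \<in> ?P"
    then obtain h where "(h, q) \<in> ?C" "h \<in> ?K" by (cases q) auto
    then show "q \<in> snd ` (?C \<inter> (?K \<times> UNIV))" by (intro image_eqI[of _ _ "(h, q)"]) auto
  qed
  ultimately show ?thesis by simp
qed

text \<open>The kernel condition is invariant under positive scaling, so directions of l1 norm 1
  suffice. These exclude zero and fit into the compact cube.\<close>

lemma l1_recovers_iff_normalized:
  assumes v: "v \<in> {..<n} \<rightarrow>\<^sub>E UNIV"
  shows "\<not> l1_recovers m n A v \<longleftrightarrow>
    (\<exists>h\<in>PiE UNIV (\<lambda>_. {-1..1}). (\<forall>i<m. (\<Sum>k<n. A (i, k) * h k) = 0) \<and>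
     (\<Sum>k<n. \<bar>h k\<bar>) = 1 \<and> l1_slope n (\<lambda>k. sgn (v k)) h \<le> 0)" (is "_ \<longleftrightarrow> ?R")
proof
  assume "\<not> l1_recovers m n A v"
  then obtain h k0 where h: "\<forall>i<m. (\<Sum>k<n. A (i, k) * h k) = 0" "k0 < n" "h k0 \<noteq> 0"
    "l1_slope n (\<lambda>k. sgn (v k)) h \<le> 0"
    using v by (auto simp: l1_recovers_iff not_less)
  define t where "t = (\<Sum>k<n. \<bar>h k\<bar>)"
  have le: "\<bar>h k\<bar> \<le> t" if "k < n" for k
    unfolding t_def using that by (intro member_le_sum) auto
  have t: "t > 0" using le[OF h(2)] h(3) by linarith
  \<comment> \<open>Coordinates from \<open>n\<close> on are set to 0, since nothing bounds them in
    \<open>h\<close>.\<close>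
  define g where "g = (\<lambda>k. if k < n then inverse t * h k else 0)"
  have "g \<in> PiE UNIV (\<lambda>_. {-1..1})"
  proof -
    have "\<bar>inverse t * h k\<bar> \<le> 1" if "k < n" for k
    proof -
      have "\<bar>inverse t * h k\<bar> = \<bar>h k\<bar> / t" using t by (simp add: abs_mult divide_inverse)
      also have "\<dots> \<le> 1" using le[OF that] t by simp
      finally show ?thesis .
    qed
    then have "\<bar>g k\<bar> \<le> 1" for k by (simp add: g_def)
    then show ?thesis by (auto simp: abs_le_iff)
  qed
  moreover have "(\<Sum>k<n. A (i, k) * g k) = 0" if "i < m" for i
  proof -
    have "(\<Sum>k<n. A (i, k) * g k) = inverse t * (\<Sum>k<n. A (i, k) * h k)"
      unfolding sum_distrib_left by (intro sum.cong) (auto simp: g_def)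
    with h(1) that show ?thesis by simp
  qed
  moreover have "(\<Sum>k<n. \<bar>g k\<bar>) = 1"
  proof -
    have "(\<Sum>k<n. \<bar>g k\<bar>) = inverse t * (\<Sum>k<n. \<bar>h k\<bar>)"
      unfolding sum_distrib_left using t by (intro sum.cong) (auto simp: g_def abs_mult)
    with t show ?thesis by (simp add: t_def)
  qed
  moreover have "l1_slope n (\<lambda>k. sgn (v k)) g = l1_slope n (\<lambda>k. sgn (v k)) (\<lambda>k. inverse t * h k)"
    unfolding l1_slope_def by (intro sum.cong) (auto simp: g_def)
  then have "l1_slope n (\<lambda>k. sgn (v k)) g \<le> 0"
    using h(4) t by (simp add: l1_slope_scale mult_nonneg_nonpos)
  ultimately show ?R by blast
next
  assume ?R
  then obtain h where h: "\<forall>i<m. (\<Sum>k<n. A (i, k) * h k) = 0"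
     "(\<Sum>k<n. \<bar>h k\<bar>) = 1" "l1_slope n (\<lambda>k. sgn (v k)) h \<le> 0" by blast
  have "\<exists>k<n. h k \<noteq> 0"
  proof (rule ccontr)
    assume "\<not> ?thesis"
    then have "(\<Sum>k<n. \<bar>h k\<bar>) = 0" by (intro sum.neutral) auto
    with h(2) show False by simp
  qed
  with h show "\<not> l1_recovers m n A v" unfolding l1_recovers_iff[OF v] not_all not_imp not_less by blast
qed

text \<open>The criterion quantifies over uncountably many directions, so measurability is drawn
  from closedness of the failure set. That set is formulated for sign vectors because
  \<open>sgn\<close> is Borel but not continuous.\<close>

lemma measurable_l1_recovers:
  fixes A :: "'a \<Rightarrow> rmat" and v :: "'a \<Rightarrow> rvec"
  assumes A: "\<And>i k. i < m \<Longrightarrow> k < n \<Longrightarrow> (\<lambda>\<omega>. A \<omega> (i, k)) \<in> borel_measurable M"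
    and v: "\<And>k. k < n \<Longrightarrow> (\<lambda>\<omega>. v \<omega> k) \<in> borel_measurable M"
    and ext: "\<And>\<omega>. \<omega> \<in> space M \<Longrightarrow> v \<omega> \<in> {..<n} \<rightarrow>\<^sub>E UNIV"
  shows "{\<omega> \<in> space M. l1_recovers m n (A \<omega>) (v \<omega>)} \<in> sets M"
proof -
  \<comment> \<open>The hypotheses control only the entries inside the block; padding with zeros
    makes every coordinate measurable, hence the maps into the full function spaces.\<close>
  define A' where "A' = (\<lambda>\<omega> p. if p \<in> {..<m} \<times> {..<n} then A \<omega> p else 0)"
  define s where "s = (\<lambda>\<omega> k. if k < n then sgn (v \<omega> k) else 0)"
  define P where "P = {(A :: rmat, s :: rvec). \<exists>h\<in>PiE UNIV (\<lambda>_. {-1..1}).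
     (\<forall>i<m. (\<Sum>k<n. A (i, k) * h k) = 0) \<and> (\<Sum>k<n. \<bar>h k\<bar>) = 1 \<and> l1_slope n s h \<le> 0}"
  have "A' \<in> borel_measurable M"
  proof (rule measurable_coordinatewise_then_product)
    show "(\<lambda>\<omega>. A' \<omega> p) \<in> borel_measurable M" for p
      using A[of "fst p" "snd p"] by (cases "p \<in> {..<m} \<times> {..<n}") (auto simp: A'_def)
  qed
  moreover have "s \<in> borel_measurable M"
  proof (rule measurable_coordinatewise_then_product)
    show "(\<lambda>\<omega>. s \<omega> k) \<in> borel_measurable M" for k
      using v[of k] by (cases "k < n") (simp_all add: s_def)
  qed
  ultimately have f: "(\<lambda>\<omega>. (A' \<omega>, s \<omega>)) \<in> borel_measurable M" by measurable
  have "P \<in> sets borel" unfolding P_def by (rule borel_closed[OF closed_kernel_condition])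
  from measurable_sets[OF f this]
  have "space M - (\<lambda>\<omega>. (A' \<omega>, s \<omega>)) -` P \<inter> space M \<in> sets M" by blast
  also have "space M - (\<lambda>\<omega>. (A' \<omega>, s \<omega>)) -` P \<inter> space M
      = {\<omega> \<in> space M. l1_recovers m n (A \<omega>) (v \<omega>)}"
  proof -
    have slope: "l1_slope n (s \<omega>) h = l1_slope n (\<lambda>k. sgn (v \<omega> k)) h" for \<omega> h
      by (simp add: l1_slope_def s_def)
    have row: "(\<Sum>k<n. A' \<omega> (i, k) * h k) = (\<Sum>k<n. A \<omega> (i, k) * h k)" if "i < m" for i \<omega> h
      using that by (simp add: A'_def)
    have "(A' \<omega>, s \<omega>) \<in> P \<longleftrightarrow> \<not> l1_recovers m n (A \<omega>) (v \<omega>)" if "\<omega> \<in> space M" for \<omega>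
      unfolding l1_recovers_iff_normalized[OF ext[OF that], of m "A \<omega>"]
      by (simp add: P_def slope row cong: conj_cong)
    then show ?thesis by blast
  qed
  finally show ?thesis .
qed

section \<open>Gaussian measurements\<close>

lemma prob_space_std_normal: "prob_space std_normal_distribution"
  by (rule prob_space_normal_density) simp

lemma prob_space_gaussian_matrix: "prob_space (gaussian_matrix m n)"
  unfolding gaussian_matrix_def by (intro prob_space_PiM prob_space_std_normal)

lemma measurable_gaussian_matrix_component:
  "i < m \<Longrightarrow> k < n \<Longrightarrow> (\<lambda>A. A (i, k)) \<in> borel_measurable (gaussian_matrix m n)"
  unfolding gaussian_matrix_def
  using measurable_component_singleton[of "(i, k)" "{..<m} \<times> {..<n}" "\<lambda>_. std_normal_distribution"]
  by simp

lemma sets_l1_recovers_gaussian: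
  assumes "v \<in> {..<n} \<rightarrow>\<^sub>E UNIV" "m \<le> m'"
  shows "{A \<in> space (gaussian_matrix m' n). l1_recovers m n A v} \<in> sets (gaussian_matrix m' n)"
  using assms by (intro measurable_l1_recovers measurable_gaussian_matrix_component) auto

text \<open>The entries are i.i.d., so any selection of distinct rows is again a Gaussian matrix.
  This serves both for leading rows and for the marginals of the design.\<close>

lemma gaussian_matrix_select_rows:
  assumes r: "inj_on r {..<m}" "\<And>i. i < m \<Longrightarrow> r i < m'"
  shows "distr (gaussian_matrix m' n) (gaussian_matrix m n) (\<lambda>A. \<lambda>(i, k)\<in>{..<m} \<times> {..<n}. A (r i, k))
    = gaussian_matrix m n"
proof -
  define f where "f = (\<lambda>p :: nat \<times> nat. (r (fst p), snd p))"
  have "inj_on f ({..<m} \<times> {..<n})" using r(1) by (auto simp: inj_on_def f_def)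
  moreover have "f \<in> {..<m} \<times> {..<n} \<rightarrow> {..<m'} \<times> {..<n}" using r(2) by (auto simp: f_def)
  ultimately have "distr (gaussian_matrix m' n) (gaussian_matrix m n) (\<lambda>A. \<lambda>p\<in>{..<m} \<times> {..<n}. A (f p))
    = gaussian_matrix m n"
    unfolding gaussian_matrix_def by (intro distr_PiM_reindex prob_space_std_normal)
  moreover have "(\<lambda>A :: rmat. \<lambda>p\<in>{..<m} \<times> {..<n}. A (f p))
      = (\<lambda>A. \<lambda>(i, k)\<in>{..<m} \<times> {..<n}. A (r i, k))"
    by (auto simp: fun_eq_iff f_def restrict_def)
  ultimately show ?thesis by simp
qed

lemma measurable_select_rows:
  assumes r: "\<And>i. i < m \<Longrightarrow> r i < m'"
  shows "(\<lambda>A. \<lambda>(i, k)\<in>{..<m} \<times> {..<n}. A (r i, k)) \<in> gaussian_matrix m' n \<rightarrow>\<^sub>M gaussian_matrix m n"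
  unfolding gaussian_matrix_def[of m]
proof (rule measurable_restrict)
  fix p assume "p \<in> {..<m} \<times> {..<n}"
  then show "(\<lambda>A. case p of (i, k) \<Rightarrow> A (r i, k)) \<in> gaussian_matrix m' n \<rightarrow>\<^sub>M std_normal_distribution"
    using measurable_gaussian_matrix_component[OF r, of "fst p" "snd p"] by auto
qed

text \<open>Only the first \<open>m\<close> rows enter the event, and they form a Gaussian matrix
  themselves. This puts problems with different numbers of rows on one probability space.\<close>

lemma l1_recovery_prob_leading_rows:
  assumes v: "v \<in> {..<n} \<rightarrow>\<^sub>E UNIV" and "m \<le> m'"
  shows "measure (gaussian_matrix m' n) {A \<in> space (gaussian_matrix m' n). l1_recovers m n A v}
    = l1_recovery_prob m n v"
proof -
  let ?f = "\<lambda>A :: rmat. \<lambda>(i, k)\<in>{..<m} \<times> {..<n}. A (i, k)"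
  have m: "i < m \<Longrightarrow> i < m'" for i using assms by simp
  have f: "?f \<in> gaussian_matrix m' n \<rightarrow>\<^sub>M gaussian_matrix m n"
    by (rule measurable_select_rows[OF m])
  have "l1_recovery_prob m n v = measure (distr (gaussian_matrix m' n) (gaussian_matrix m n) ?f)
     {A \<in> space (gaussian_matrix m n). l1_recovers m n A v}"
    unfolding l1_recovery_prob_def by (subst gaussian_matrix_select_rows[OF _ m]) (auto simp: inj_on_def)
  also have "\<dots> = measure (gaussian_matrix m' n)
     (?f -` {A \<in> space (gaussian_matrix m n). l1_recovers m n A v} \<inter> space (gaussian_matrix m' n))"
    by (intro measure_distr f sets_l1_recovers_gaussian v order_refl)
  also have "?f -` {A \<in> space (gaussian_matrix m n). l1_recovers m n A v} \<inter> space (gaussian_matrix m' n)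
     = {A \<in> space (gaussian_matrix m' n). l1_recovers m n A v}"
    using measurable_space[OF f] l1_recovers_cong[OF v, of m "?f _"] by auto
  finally show ?thesis by simp
qed

lemma l1_recovery_prob_mono_rows:
  assumes v: "v \<in> {..<n} \<rightarrow>\<^sub>E UNIV" and m: "m \<le> m'"
  shows "l1_recovery_prob m n v \<le> l1_recovery_prob m' n v"
proof -
  interpret prob_space "gaussian_matrix m' n" by (rule prob_space_gaussian_matrix)
  show ?thesis
    unfolding l1_recovery_prob_leading_rows[OF v m, symmetric] unfolding l1_recovery_prob_def
    using l1_recovers_more_rows[OF v m] sets_l1_recovers_gaussian[OF v order_refl]
    by (intro finite_measure_mono) auto
qed

lemma l1_recovery_prob_sparser:
  assumes v: "v \<in> {..<n} \<rightarrow>\<^sub>E UNIV" and w: "w \<in> {..<n} \<rightarrow>\<^sub>E UNIV"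
    and eq: "\<And>k. k < n \<Longrightarrow> v k \<noteq> 0 \<Longrightarrow> w k = v k"
  shows "l1_recovery_prob m n w \<le> l1_recovery_prob m n v"
proof -
  interpret prob_space "gaussian_matrix m n" by (rule prob_space_gaussian_matrix)
  show ?thesis
    unfolding l1_recovery_prob_def
    using l1_recovers_sparser[OF v w eq] sets_l1_recovers_gaussian[OF v order_refl]
    by (intro finite_measure_mono) auto
qed

text \<open>The sequence picks a violator of the bound wherever there is one, and any member of
  \<open>A N\<close> elsewhere. Its convergence to \<open>L\<close> leaves only finitely many
  \<open>N\<close> with a violator.\<close>

lemma eventually_uniform_if_sequences:
  fixes p :: "nat \<Rightarrow> 'a \<Rightarrow> real"
  assumes ne: "\<And>N. \<exists>v. v \<in> A N"
    and lim: "\<And>v. (\<And>N. v N \<in> A N) \<Longrightarrow> (\<lambda>N. p N (v N)) \<longlonglongrightarrow> L" and a: "a < L"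
  shows "\<forall>\<^sub>F N in sequentially. \<forall>w\<in>A N. a < p N w"
proof -
  define v where "v N = (if \<exists>w\<in>A N. p N w \<le> a then SOME w. w \<in> A N \<and> p N w \<le> a else SOME w. w \<in> A N)" for N
  have worst: "v N \<in> A N \<and> p N (v N) \<le> a" if "\<exists>w\<in>A N. p N w \<le> a" for N
  proof -
    have "\<exists>w. w \<in> A N \<and> p N w \<le> a" using that by blast
    from someI_ex[OF this] show ?thesis unfolding v_def if_P[OF that] .
  qed
  have "v N \<in> A N" for N
  proof (cases "\<exists>w\<in>A N. p N w \<le> a")
    case True
    then show ?thesis using worst by blast
  next
    case False
    show ?thesis unfolding v_def if_not_P[OF False] by (rule someI_ex[OF ne])
  qed
  then have "(\<lambda>N. p N (v N)) \<longlonglongrightarrow> L" by (rule lim)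
  from LIMSEQ_D[OF this, of "L - a"] a
  obtain N0 where N0: "\<forall>N\<ge>N0. norm (p N (v N) - L) < L - a" by auto
  have "\<forall>w\<in>A N. a < p N w" if "N \<ge> N0" for N
  proof -
    have "norm (p N (v N) - L) < L - a" using N0 that by blast
    then have "a < p N (v N)" unfolding real_norm_def by linarith
    then show ?thesis using worst[of N] by (meson leD not_le)
  qed
  then show ?thesis unfolding eventually_sequentially by blast
qed

text \<open>The threshold is stated for each sequence of signals; applying it to a sequence of
  worst signals makes it uniform.\<close>

lemma overmeasuring_factor_uniform:
  assumes c: "overmeasuring_factor c" and S: "0 < S" "S < 1" and \<epsilon>: "\<epsilon> > 0" and \<delta>: "\<delta> > 0"
  shows "\<forall>\<^sub>F N in sequentially. \<forall>v\<in>sparse_vectors (nat \<lfloor>S * real N\<rfloor>) N.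
    l1_recovery_prob (nat \<lceil>(c S + \<epsilon>) * real (nat \<lfloor>S * real N\<rfloor>)\<rceil>) N v > 1 - \<delta>"
proof (rule eventually_uniform_if_sequences)
  show "\<exists>v. v \<in> sparse_vectors (nat \<lfloor>S * real N\<rfloor>) N" for N
    using S(2) by (intro sparse_vectors_nonempty nat_floor_mult_le less_imp_le)
  have S': "S \<in> {0<..<1}" using S by simp
  show "(\<lambda>N. l1_recovery_prob (nat \<lceil>(c S + \<epsilon>) * real (nat \<lfloor>S * real N\<rfloor>)\<rceil>) N (v N)) \<longlonglongrightarrow> 1"
    if "\<And>N. v N \<in> sparse_vectors (nat \<lfloor>S * real N\<rfloor>) N" for v
    using c[unfolded overmeasuring_factor_def, THEN conjunct2, THEN conjunct2] S' \<epsilon> that by blast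
  show "1 - \<delta> < 1" using \<delta> by simp
qed

text \<open>Signal and matrix are independent, so Fubini allows fixing the signal. Outside the
  exceptional set \<open>B\<close> its support has at most \<open>K\<close> entries and the bound
  for fixed signals applies. Here \<open>m0\<close> counts the rows of that bound, \<open>m\<close>
  those used for recovery, \<open>m'\<close> those drawn.\<close>

lemma recovery_failure_random_signal:
  fixes v :: "'a \<Rightarrow> rvec"
  assumes J: "prob_space J"
    and v: "\<And>k. k < N \<Longrightarrow> (\<lambda>z. v z k) \<in> borel_measurable J"
    and ext: "\<And>z. z \<in> space J \<Longrightarrow> v z \<in> {..<N} \<rightarrow>\<^sub>E UNIV"
    and B: "B \<in> sets J" "\<And>z. z \<in> space J \<Longrightarrow> K < card {k \<in> {..<N}. v z k \<noteq> 0} \<Longrightarrow> z \<in> B"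
    and K: "K \<le> N" and m: "m0 \<le> m" "m \<le> m'" and \<delta>: "\<delta> \<ge> 0"
    and prob: "\<And>w. w \<in> sparse_vectors K N \<Longrightarrow> l1_recovery_prob m0 N w > 1 - \<delta>"
  defines "P \<equiv> J \<Otimes>\<^sub>M gaussian_matrix m' N"
  shows "{q \<in> space P. \<not> l1_recovers m N (snd q) (v (fst q))} \<in> sets P"
    and "measure P {q \<in> space P. \<not> l1_recovers m N (snd q) (v (fst q))} \<le> measure J B + \<delta>"
proof -
  interpret J: prob_space J by fact
  interpret G: prob_space "gaussian_matrix m' N" by (rule prob_space_gaussian_matrix)
  interpret P: pair_prob_space J "gaussian_matrix m' N" ..
  let ?F = "{q \<in> space P. \<not> l1_recovers m N (snd q) (v (fst q))}"
  have "{q \<in> space P. l1_recovers m N (snd q) (v (fst q))} \<in> sets P"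
    unfolding P_def
  proof (rule measurable_l1_recovers)
    fix i k assume "i < m" "k < N"
    then have "(\<lambda>A. A (i, k)) \<in> borel_measurable (gaussian_matrix m' N)"
      using m by (intro measurable_gaussian_matrix_component) auto
    then show "(\<lambda>q. snd q (i, k)) \<in> borel_measurable (J \<Otimes>\<^sub>M gaussian_matrix m' N)"
      by (rule measurable_compose[OF measurable_snd])
  next
    fix k assume "k < N"
    from v[OF this] show "(\<lambda>q. v (fst q) k) \<in> borel_measurable (J \<Otimes>\<^sub>M gaussian_matrix m' N)"
      by (rule measurable_compose[OF measurable_fst])
  qed (simp add: space_pair_measure ext mem_Times_iff)
  then have "space P - {q \<in> space P. l1_recovers m N (snd q) (v (fst q))} \<in> sets P" by blast
  also have "space P - {q \<in> space P. l1_recovers m N (snd q) (v (fst q))} = ?F" by blast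
  finally show F: "?F \<in> sets P" .
  have sect: "emeasure (gaussian_matrix m' N) (Pair z -` ?F) \<le> indicator B z + ennreal \<delta>"
    if z: "z \<in> space J" for z
  proof (cases "z \<in> B")
    case True
    then show ?thesis using G.emeasure_le_1 by (simp add: add_increasing2)
  next
    case False
    then have supp: "card {k \<in> {..<N}. v z k \<noteq> 0} \<le> K" using B(2)[OF z] by (meson not_le)
    \<comment> \<open>Compare with a vector having exactly \<open>K\<close> nonzero entries. Passing
      from \<open>m0\<close> to \<open>m\<close> rows and from \<open>w\<close> back to
      \<open>v z\<close> can only raise the recovery probability.\<close>
    from sparse_vectors_extend[OF ext[OF z] supp K]
    obtain w where w: "w \<in> sparse_vectors K N" "\<forall>k<N. v z k \<noteq> 0 \<longrightarrow> w k = v z k" by blast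
    have "1 - \<delta> < l1_recovery_prob m0 N w" by (rule prob[OF w(1)])
    also have "\<dots> \<le> l1_recovery_prob m N w"
      using w(1) m by (intro l1_recovery_prob_mono_rows) (auto simp: sparse_vectors_def)
    also have "\<dots> \<le> l1_recovery_prob m N (v z)"
      using w ext[OF z] by (intro l1_recovery_prob_sparser) (auto simp: sparse_vectors_def)
    finally have "1 - l1_recovery_prob m N (v z) \<le> \<delta>" by simp
    moreover have "Pair z -` ?F = space (gaussian_matrix m' N)
        - {A \<in> space (gaussian_matrix m' N). l1_recovers m N A (v z)}"
      using z by (auto simp: P_def space_pair_measure)
    then have "measure (gaussian_matrix m' N) (Pair z -` ?F) = 1 - l1_recovery_prob m N (v z)"
      by (simp add: G.prob_compl sets_l1_recovers_gaussian ext z m(2) l1_recovery_prob_leading_rows)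
    ultimately show ?thesis using False by (simp add: G.emeasure_eq_measure ennreal_leI)
  qed
  have "emeasure P ?F = (\<integral>\<^sup>+ z. emeasure (gaussian_matrix m' N) (Pair z -` ?F) \<partial>J)"
    using F unfolding P_def by (intro G.emeasure_pair_measure_alt) auto
  also have "\<dots> \<le> (\<integral>\<^sup>+ z. indicator B z + ennreal \<delta> \<partial>J)"
    by (intro nn_integral_mono sect)
  also have "\<dots> = emeasure J B + ennreal \<delta>"
    using B(1) by (subst nn_integral_add) (auto simp: J.emeasure_space_1)
  also have "\<dots> = ennreal (measure J B + \<delta>)" using \<delta> by (simp add: J.emeasure_eq_measure)
  finally have "emeasure P ?F \<le> ennreal (measure J B + \<delta>)" .
  then show "measure P ?F \<le> measure J B + \<delta>"
    using \<delta> unfolding P_def P.emeasure_eq_measure by (subst (asm) ennreal_le_iff) auto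
qed

section \<open>Support sizes in the signal model\<close>

text \<open>Chebyshev's inequality for the number of failing events. The variance involves only
  pairs, so the pairwise product rule \<open>q2\<close> is enough. In the application
  \<open>E n\<close> says that the relevant components vanish at position \<open>n\<close>.\<close>

lemma (in prob_space) card_failures_le:
  fixes E :: "nat \<Rightarrow> 'a set"
  assumes E: "\<And>n. n < N \<Longrightarrow> E n \<in> events"
    and q: "\<And>n. n < N \<Longrightarrow> prob (E n) = q"
    and q2: "\<And>n m. n < N \<Longrightarrow> m < N \<Longrightarrow> n \<noteq> m \<Longrightarrow> prob (E n \<inter> E m) = q\<^sup>2"
    and S: "1 - q \<le> S" "S < S'" and N: "N > 0"
  defines "B \<equiv> {\<omega> \<in> space M. real (card {n \<in> {..<N}. \<omega> \<notin> E n}) \<ge> S' * real N}"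
  shows "B \<in> events" "prob B \<le> 1 / (real N * (S' - S)\<^sup>2)"
proof -
  define X where "X = (\<lambda>n \<omega>. indicator (E n) \<omega> - q :: real)"
  define f where "f = (\<lambda>\<omega>. \<Sum>n<N. X n \<omega>)"
  have X[measurable]: "X n \<in> borel_measurable M" if "n < N" for n
    using E[OF that] by (simp add: X_def)
  have f: "f \<in> borel_measurable M" unfolding f_def by (intro borel_measurable_sum X) simp
  have count: "real (card {n \<in> {..<N}. \<omega> \<notin> E n}) = real N * (1 - q) - f \<omega>" for \<omega>
  proof -
    have "real (card {n \<in> {..<N}. \<omega> \<notin> E n}) = (\<Sum>n\<in>{n \<in> {..<N}. \<omega> \<notin> E n}. 1)" by simp
    also have "\<dots> = (\<Sum>n<N. if \<omega> \<notin> E n then 1 else 0)" by (rule sum.inter_filter) simp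
    also have "\<dots> = (\<Sum>n<N. 1 - indicator (E n) \<omega>)" by (intro sum.cong) auto
    finally have "real (card {n \<in> {..<N}. \<omega> \<notin> E n}) = (\<Sum>n<N. 1 - indicator (E n) \<omega>)" .
    then show ?thesis by (simp add: f_def X_def sum_subtractf algebra_simps)
  qed
  have "B = {\<omega> \<in> space M. real N * (1 - q) - f \<omega> \<ge> S' * real N}" by (simp only: B_def count)
  also have "\<dots> \<in> events" using f by measurable
  finally show "B \<in> events" .
  have int: "integrable M (\<lambda>\<omega>. X n \<omega> * X m \<omega>)" if "n < N" "m < N" for n m
  proof (rule integrable_const_bound)
    have bound: "\<bar>X k \<omega>\<bar> \<le> 1 + \<bar>q\<bar>" for k \<omega> by (auto simp: X_def indicator_def)
    have "norm (X n \<omega> * X m \<omega>) \<le> (1 + \<bar>q\<bar>) * (1 + \<bar>q\<bar>)" for \<omega>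
      unfolding real_norm_def abs_mult by (intro mult_mono bound) auto
    then show "AE \<omega> in M. norm (X n \<omega> * X m \<omega>) \<le> (1 + \<bar>q\<bar>) * (1 + \<bar>q\<bar>)" by simp
    show "(\<lambda>\<omega>. X n \<omega> * X m \<omega>) \<in> borel_measurable M" using that by simp
  qed
  \<comment> \<open>The diagonal gives the Bernoulli variance; off it \<open>q2\<close> makes the
    covariance vanish, so the second moment of \<open>f\<close> grows only linearly in
    \<open>N\<close>.\<close>
  have cov: "expectation (\<lambda>\<omega>. X n \<omega> * X m \<omega>) = (if n = m then q - q\<^sup>2 else 0)"
    if nm: "n < N" "m < N" for n m
  proof -
    have "X n \<omega> * X m \<omega> = indicator (E n \<inter> E m) \<omega> - q * indicator (E n) \<omega> - q * indicator (E m) \<omega> + q\<^sup>2" for \<omega>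
      unfolding X_def indicator_inter_arith by (simp add: power2_eq_square algebra_simps)
    moreover have "integrable M (indicator (E n) :: 'a \<Rightarrow> real)" "integrable M (indicator (E m) :: 'a \<Rightarrow> real)"
      "integrable M (indicator (E n \<inter> E m) :: 'a \<Rightarrow> real)"
      using E nm by (auto intro!: integrable_real_indicator simp: emeasure_eq_measure)
    ultimately have "expectation (\<lambda>\<omega>. X n \<omega> * X m \<omega>)
        = prob (E n \<inter> E m) - q * prob (E n) - q * prob (E m) + q\<^sup>2"
      using E nm by (simp add: prob_space)
    then show ?thesis using q nm q2[of n m] by (auto simp: power2_eq_square)
  qed
  have f2: "(f \<omega>)\<^sup>2 = (\<Sum>n<N. \<Sum>m<N. X n \<omega> * X m \<omega>)" for \<omega>
    by (simp add: f_def power2_eq_square sum_product)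
  have "expectation (\<lambda>\<omega>. (f \<omega>)\<^sup>2) = (\<Sum>n<N. expectation (\<lambda>\<omega>. \<Sum>m<N. X n \<omega> * X m \<omega>))"
    unfolding f2 by (intro Bochner_Integration.integral_sum Bochner_Integration.integrable_sum int) auto
  also have "\<dots> = (\<Sum>n<N. \<Sum>m<N. expectation (\<lambda>\<omega>. X n \<omega> * X m \<omega>))"
    by (intro sum.cong refl Bochner_Integration.integral_sum int) auto
  also have "\<dots> = (\<Sum>n<N. \<Sum>m<N. if n = m then q - q\<^sup>2 else 0)"
    by (intro sum.cong refl cov) auto
  also have "\<dots> = real N * (q - q\<^sup>2)" by simp
  also have "\<dots> \<le> real N * 1"
  proof -
    have "q - q\<^sup>2 = 1/4 - (q - 1/2)\<^sup>2" by (simp add: power2_eq_square algebra_simps)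
    moreover have "0 \<le> (q - 1/2)\<^sup>2" by (rule zero_le_power2)
    ultimately have "q - q\<^sup>2 \<le> 1" by linarith
    then show ?thesis by (intro mult_left_mono) auto
  qed
  finally have var: "expectation (\<lambda>\<omega>. (f \<omega>)\<^sup>2) \<le> real N" by simp
  have a: "real N * (S' - S) > 0" using N S by simp
  \<comment> \<open>A count of at least \<open>S' * N\<close> forces \<open>- f\<close> to be at
    least \<open>N * (S' - (1 - q))\<close>, and \<open>1 - q\<close> is at most
    \<open>S\<close>.\<close>
  have "B \<subseteq> {\<omega> \<in> space M. real N * (S' - S) \<le> \<bar>f \<omega>\<bar>}"
  proof -
    have "real N * (1 - q) \<le> real N * S" using S by (intro mult_left_mono) auto
    then show ?thesis unfolding B_def count by (auto simp: algebra_simps)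
  qed
  then have "prob B \<le> prob {\<omega> \<in> space M. real N * (S' - S) \<le> \<bar>f \<omega>\<bar>}"
    using f by (intro finite_measure_mono) measurable
  also have "\<dots> \<le> expectation (\<lambda>\<omega>. (f \<omega>)\<^sup>2) / (real N * (S' - S))\<^sup>2"
  proof (intro second_moment_method f a)
    show "integrable M (\<lambda>\<omega>. (f \<omega>)\<^sup>2)"
      unfolding f2 by (intro Bochner_Integration.integrable_sum int) auto
  qed
  also have "\<dots> \<le> real N / (real N * (S' - S))\<^sup>2"
    using var by (intro divide_right_mono) auto
  also have "\<dots> = 1 / (real N * (S' - S)\<^sup>2)"
    using N by (simp add: power2_eq_square)
  finally show "prob B \<le> 1 / (real N * (S' - S)\<^sup>2)" .
qed

section \<open>Zero probabilities in the signal model\<close>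

lemma measure_pair_Times:
  assumes "prob_space M" "prob_space N" "A \<in> sets M" "B \<in> sets N"
  shows "measure (M \<Otimes>\<^sub>M N) (A \<times> B) = measure M A * measure N B"
proof -
  interpret M: prob_space M by fact
  interpret N: prob_space N by fact
  interpret pair_prob_space M N ..
  have "ennreal (measure (M \<Otimes>\<^sub>M N) (A \<times> B)) = ennreal (measure M A * measure N B)"
    using assms
    by (simp add: N.emeasure_pair_measure_Times M.emeasure_eq_measure N.emeasure_eq_measure
        ennreal_mult flip: emeasure_eq_measure)
  then show ?thesis by simp
qed

lemma sets_sparse_gaussian: "sets (sparse_gaussian S \<sigma>) = sets borel"
  by (simp add: sparse_gaussian_def)

lemma measurable_sparse_gaussian_sampler:
  "(\<lambda>(b, g). if b then g else 0) \<in> measure_pmf (bernoulli_pmf S) \<Otimes>\<^sub>M density lborel (normal_density 0 \<sigma>)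
     \<rightarrow>\<^sub>M (borel :: real measure)"
proof -
  have meas: "(\<lambda>p. if fst p then snd p else 0) \<in> count_space UNIV \<Otimes>\<^sub>M borel \<rightarrow>\<^sub>M (borel :: real measure)"
    by measurable
  have eq: "sets (measure_pmf (bernoulli_pmf S) \<Otimes>\<^sub>M density lborel (normal_density 0 \<sigma>))
      = sets (count_space UNIV \<Otimes>\<^sub>M borel)"
    by (intro sets_pair_measure_cong) auto
  show ?thesis unfolding measurable_cong_sets[OF eq refl] case_prod_beta by (rule meas)
qed

text \<open>The mass at zero comes from the Bernoulli variable being \<open>False\<close>. A lower
  bound is what is wanted, since supports are to be bounded from above.\<close>

lemma
  assumes "\<sigma> > 0"
  shows prob_space_sparse_gaussian: "prob_space (sparse_gaussian S \<sigma>)"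
    and sparse_gaussian_zero: "0 \<le> S \<Longrightarrow> S \<le> 1 \<Longrightarrow> 1 - S \<le> measure (sparse_gaussian S \<sigma>) {0}"
proof -
  let ?n = "density lborel (normal_density 0 \<sigma>)"
  interpret n: prob_space ?n using assms by (rule prob_space_normal_density)
  interpret p: pair_prob_space "measure_pmf (bernoulli_pmf S)" ?n ..
  show "prob_space (sparse_gaussian S \<sigma>)"
    unfolding sparse_gaussian_def by (intro p.prob_space_distr measurable_sparse_gaussian_sampler)
  assume S: "0 \<le> S" "S \<le> 1"
  let ?f = "\<lambda>(b, g). if b then g else 0 :: real"
  let ?P = "measure_pmf (bernoulli_pmf S) \<Otimes>\<^sub>M ?n"
  have "?f -` {0} \<inter> space ?P \<in> sets ?P"
    by (rule measurable_sets[OF measurable_sparse_gaussian_sampler]) simp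
  moreover have "{False} \<times> UNIV \<subseteq> ?f -` {0} \<inter> space ?P" by (auto simp: space_pair_measure)
  ultimately have "measure ?P ({False} \<times> UNIV) \<le> measure (sparse_gaussian S \<sigma>) {0}"
    unfolding sparse_gaussian_def measure_distr[OF measurable_sparse_gaussian_sampler borel_singleton[OF sets.empty_sets]]
    by (intro p.finite_measure_mono)
  moreover have "measure ?P ({False} \<times> UNIV)
      = measure (measure_pmf (bernoulli_pmf S)) {False} * measure ?n UNIV"
    by (intro measure_pair_Times n.prob_space_axioms measure_pmf.prob_space_axioms) auto
  moreover have "measure ?n UNIV = 1" using n.prob_space by simp
  moreover have "measure (measure_pmf (bernoulli_pmf S)) {False} = 1 - S"
    using S by (simp add: measure_pmf_single)
  ultimately show "1 - S \<le> measure (sparse_gaussian S \<sigma>) {0}" by simp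
qed

text \<open>The event is a box with side \<open>{0}\<close> on \<open>A\<close> and the whole line
  elsewhere, so its probability is a product.\<close>

lemma measure_PiM_zero_on:
  fixes \<mu> :: "real measure"
  assumes \<mu>: "prob_space \<mu>" "sets \<mu> = sets borel" and A: "A \<subseteq> {..<N :: nat}"
  defines "P \<equiv> \<Pi>\<^sub>M n\<in>{..<N}. \<mu>"
  shows "{x \<in> space P. \<forall>n\<in>A. x n = 0} \<in> sets P"
    and "measure P {x \<in> space P. \<forall>n\<in>A. x n = 0} = measure \<mu> {0} ^ card A"
proof -
  interpret \<mu>: prob_space \<mu> by fact
  interpret finite_product_prob_space "\<lambda>_ :: nat. \<mu>" "{..<N}"
    by unfold_locales auto
  define X where "X = (\<lambda>n. if n \<in> A then {0 :: real} else UNIV)"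
  have [simp]: "space \<mu> = UNIV" using sets_eq_imp_space_eq[OF \<mu>(2)] by simp
  have X: "X n \<in> sets \<mu>" for n by (simp add: X_def \<mu>(2))
  have eq: "{x \<in> space P. \<forall>n\<in>A. x n = 0} = (\<Pi>\<^sub>E n\<in>{..<N}. X n)"
  proof (rule set_eqI)
    fix x
    have "(\<forall>n\<in>{..<N}. x n \<in> X n) \<longleftrightarrow> (\<forall>n\<in>A. x n = 0)" using A by (auto simp: X_def split: if_splits)
    then show "x \<in> {x \<in> space P. \<forall>n\<in>A. x n = 0} \<longleftrightarrow> x \<in> (\<Pi>\<^sub>E n\<in>{..<N}. X n)"
      by (simp only: P_def space_PiM PiE_iff) (simp add: PiE_iff conj_commute)
  qed
  show "{x \<in> space P. \<forall>n\<in>A. x n = 0} \<in> sets P"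
    unfolding eq unfolding P_def by (intro sets_PiM_I_finite X) simp
  have "measure P {x \<in> space P. \<forall>n\<in>A. x n = 0} = (\<Prod>n<N. measure \<mu> (X n))"
    unfolding eq unfolding P_def by (intro prob_times X)
  also have "\<dots> = (\<Prod>n\<in>A. measure \<mu> {0})"
    using A \<mu>.prob_space by (intro prod.mono_neutral_cong_right) (auto simp: X_def)
  finally show "measure P {x \<in> space P. \<forall>n\<in>A. x n = 0} = measure \<mu> {0} ^ card A" by simp
qed

lemma prob_space_jsm1: "\<sigma> > 0 \<Longrightarrow> prob_space (jsm1 S\<^sub>C S \<sigma> N)"
  unfolding jsm1_def
  by (intro prob_space_pair prob_space_PiM prob_space_sparse_gaussian)

lemma measurable_jsm1_common:
  assumes "n < N"
  shows "(\<lambda>z. fst z n) \<in> borel_measurable (jsm1 S\<^sub>C S \<sigma> N)"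
  unfolding jsm1_def
proof (rule measurable_compose[OF measurable_fst])
  have "(\<lambda>x. x n) \<in> (\<Pi>\<^sub>M n\<in>{..<N}. sparse_gaussian S\<^sub>C \<sigma>) \<rightarrow>\<^sub>M sparse_gaussian S\<^sub>C \<sigma>"
    using assms by (intro measurable_component_singleton) simp
  then show "(\<lambda>x. x n) \<in> borel_measurable (\<Pi>\<^sub>M n\<in>{..<N}. sparse_gaussian S\<^sub>C \<sigma>)"
    unfolding measurable_cong_sets[OF refl sets_sparse_gaussian] .
qed

lemma measurable_jsm1_innovation:
  assumes "n < N" "j \<in> {1, 2}"
  shows "(\<lambda>z. snd z j n) \<in> borel_measurable (jsm1 S\<^sub>C S \<sigma> N)"
  unfolding jsm1_def
proof (rule measurable_compose[OF measurable_snd])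
  have "(\<lambda>x. x n) \<in> (\<Pi>\<^sub>M n\<in>{..<N}. sparse_gaussian (S j) \<sigma>) \<rightarrow>\<^sub>M borel"
    using measurable_component_singleton[of n "{..<N}" "\<lambda>_. sparse_gaussian (S j) \<sigma>"] assms
    unfolding measurable_cong_sets[OF refl sets_sparse_gaussian] by simp
  then show "(\<lambda>w. w j n) \<in> borel_measurable (\<Pi>\<^sub>M j\<in>{1, 2}. \<Pi>\<^sub>M n\<in>{..<N}. sparse_gaussian (S j) \<sigma>)"
    by (rule measurable_compose[OF measurable_component_singleton[OF assms(2)]])
qed

text \<open>The flag \<open>b\<close> tells whether the common component is counted.\<close>

lemma
  fixes b :: bool and \<sigma> S\<^sub>C S\<^sub>I :: real and N :: nat
  assumes \<sigma>: "\<sigma> > 0" and A: "A \<subseteq> {..<N}"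
  defines "J \<equiv> jsm1 S\<^sub>C (\<lambda>j. S\<^sub>I) \<sigma> N"
  defines "E \<equiv> {z \<in> space J. \<forall>n\<in>A. (b \<longrightarrow> fst z n = 0) \<and> snd z 1 n = 0 \<and> snd z 2 n = 0}"
  shows sets_jsm1_zero_on: "E \<in> sets J"
    and measure_jsm1_zero_on: "measure J E = ((if b then measure (sparse_gaussian S\<^sub>C \<sigma>) {0} else 1)
      * (measure (sparse_gaussian S\<^sub>I \<sigma>) {0})\<^sup>2) ^ card A"
proof -
  let ?C = "\<Pi>\<^sub>M n\<in>{..<N}. sparse_gaussian S\<^sub>C \<sigma>" and ?I = "\<Pi>\<^sub>M n\<in>{..<N}. sparse_gaussian S\<^sub>I \<sigma>"
  let ?W = "\<Pi>\<^sub>M j\<in>{1, 2 :: nat}. ?I"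
  note sg = prob_space_sparse_gaussian[OF \<sigma>] sets_sparse_gaussian
  \<comment> \<open>For \<open>b\<close> false the empty index set makes \<open>F\<close> the whole
    space, of measure \<open>1 ^ card A\<close>.\<close>
  define F where "F = {x \<in> space ?C. \<forall>n\<in>(if b then A else {}). x n = 0}"
  define G where "G = {x \<in> space ?I. \<forall>n\<in>A. x n = 0}"
  have F: "F \<in> sets ?C"
    "measure ?C F = (if b then measure (sparse_gaussian S\<^sub>C \<sigma>) {0} else 1) ^ card A"
    using measure_PiM_zero_on[OF sg, of "if b then A else {}" N] A by (auto simp: F_def)
  have G: "G \<in> sets ?I" "measure ?I G = measure (sparse_gaussian S\<^sub>I \<sigma>) {0} ^ card A"
    using measure_PiM_zero_on[OF sg A] by (auto simp: G_def)
  have C: "prob_space ?C" and I: "prob_space ?I" and W: "prob_space ?W"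
    by (intro prob_space_PiM sg)+
  interpret I: prob_space ?I by fact
  interpret W: finite_product_prob_space "\<lambda>_ :: nat. ?I" "{1, 2}"
    by unfold_locales auto
  have GW: "(\<Pi>\<^sub>E j\<in>{1, 2 :: nat}. G) \<in> sets ?W" using G by (intro sets_PiM_I_finite) auto
  have E: "E = F \<times> (\<Pi>\<^sub>E j\<in>{1, 2 :: nat}. G)"
  proof -
    have 1: "x \<in> F \<longleftrightarrow> x \<in> space ?C \<and> (\<forall>n\<in>A. b \<longrightarrow> x n = 0)" for x
      by (auto simp: F_def)
    have 2: "w \<in> (\<Pi>\<^sub>E j\<in>{1, 2 :: nat}. G) \<longleftrightarrow> w \<in> space ?W \<and> (\<forall>n\<in>A. w 1 n = 0 \<and> w 2 n = 0)" for w
      unfolding space_PiM[of "{1, 2}"] PiE_iff G_def by auto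
    show ?thesis
      unfolding E_def J_def jsm1_def space_pair_measure set_eq_iff mem_Collect_eq mem_Times_iff 1 2 by blast
  qed
  show "E \<in> sets J" unfolding E J_def jsm1_def using F(1) GW by (rule pair_measureI)
  have "measure J E = measure ?C F * measure ?W (\<Pi>\<^sub>E j\<in>{1, 2 :: nat}. G)"
    unfolding E J_def jsm1_def using C W F(1) GW by (rule measure_pair_Times)
  also have "measure ?W (\<Pi>\<^sub>E j\<in>{1, 2 :: nat}. G) = (measure ?I G)\<^sup>2"
    using G by (subst W.prob_times) (auto simp: power2_eq_square)
  also have "\<dots> = ((measure (sparse_gaussian S\<^sub>I \<sigma>) {0})\<^sup>2) ^ card A"
    by (simp add: G(2) mult.commute flip: power_mult)
  finally show "measure J E = ((if b then measure (sparse_gaussian S\<^sub>C \<sigma>) {0} else 1)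
      * (measure (sparse_gaussian S\<^sub>I \<sigma>) {0})\<^sup>2) ^ card A"
    by (simp only: F(2) power_mult_distrib)
qed

text \<open>Singletons and pairs \<open>A\<close> give \<open>E A\<close> the probabilities
  \<open>q\<close> and \<open>q\<^sup>2\<close>, which is the input of
  \<open>card_failures_le\<close>. The mass at zero enters through a lower bound on
  \<open>q\<close>.\<close>

lemma jsm1_support_concentration:
  fixes b :: bool and \<sigma> S\<^sub>C S\<^sub>I :: real and N :: nat
  assumes \<sigma>: "\<sigma> > 0" and SC: "0 \<le> S\<^sub>C" "S\<^sub>C \<le> 1" and SI: "0 \<le> S\<^sub>I" "S\<^sub>I \<le> 1"
    and S: "1 - (if b then 1 - S\<^sub>C else 1) * (1 - S\<^sub>I)\<^sup>2 \<le> S" "S < S'" and N: "N > 0"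
  defines "J \<equiv> jsm1 S\<^sub>C (\<lambda>j. S\<^sub>I) \<sigma> N"
  defines "B \<equiv> {z \<in> space J. real (card {n \<in> {..<N}.
      \<not> ((b \<longrightarrow> fst z n = 0) \<and> snd z 1 n = 0 \<and> snd z 2 n = 0)}) \<ge> S' * real N}"
  shows "B \<in> sets J" "measure J B \<le> 1 / (real N * (S' - S)\<^sup>2)"
proof -
  interpret prob_space J unfolding J_def by (rule prob_space_jsm1[OF \<sigma>])
  define E where "E = (\<lambda>A. {z \<in> space J. \<forall>n\<in>A. (b \<longrightarrow> fst z n = 0) \<and> snd z 1 n = 0 \<and> snd z 2 n = 0})"
  define q where "q = (if b then measure (sparse_gaussian S\<^sub>C \<sigma>) {0} else 1)
      * (measure (sparse_gaussian S\<^sub>I \<sigma>) {0})\<^sup>2"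
  have E: "E A \<in> events" "prob (E A) = q ^ card A" if "A \<subseteq> {..<N}" for A
    unfolding E_def J_def q_def
    by (rule sets_jsm1_zero_on[OF \<sigma> that], rule measure_jsm1_zero_on[OF \<sigma> that])
  have "(if b then 1 - S\<^sub>C else 1) * (1 - S\<^sub>I)\<^sup>2 \<le> q"
    unfolding q_def using sparse_gaussian_zero[OF \<sigma> SC] sparse_gaussian_zero[OF \<sigma> SI] SC SI
    by (intro mult_mono power_mono) auto
  then have q: "1 - q \<le> S" using S by simp
  have B: "B = {z \<in> space J. real (card {n \<in> {..<N}. z \<notin> E {n}}) \<ge> S' * real N}"
    unfolding B_def by (intro Collect_cong conj_cong refl) (simp add: E_def)
  have inter: "E {n} \<inter> E {m} = E {n, m}" for n m by (auto simp: E_def)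
  have 2: "prob (E {n} \<inter> E {m}) = q\<^sup>2" if "n < N" "m < N" "n \<noteq> m" for n m
    using E(2)[of "{n, m}"] that by (simp add: inter power2_eq_square)
  have 1: "E {n} \<in> events" "prob (E {n}) = q" if "n < N" for n
    using E[of "{n}"] that by auto
  note bound = card_failures_le[of N "\<lambda>n. E {n}" q S S', OF 1 2 q S(2) N]
  show "B \<in> sets J" unfolding B by (rule bound(1))
  show "measure J B \<le> 1 / (real N * (S' - S)\<^sup>2)" unfolding B by (rule bound(2))
qed

section \<open>Recovery from matrices with shared rows\<close>

text \<open>The matrix rows are read from sensor 1 alone. This is sound for designs whose first
  \<open>m\<close> rows agree: there \<open>y 1 - y 2\<close> measures
  \<open>x 1 - x 2\<close>.\<close>

definition difference_step :: "nat \<Rightarrow> l1_step" where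
  "difference_step m = \<lparr>num_rows = m,
     matrix_coeff = (\<lambda>k j i. if j = 1 \<and> i = k then 1 else 0),
     data_coeff = (\<lambda>k j i. if i = k then (if j = 1 then 1 else - 1) else 0),
     feedback_coeff = (\<lambda>s k j i. 0)\<rparr>"

text \<open>Row \<open>k \<ge> M 1\<close> belongs to row \<open>m + (k - M 1)\<close> of the second sensor; feeding back
  \<open>x\<^sub>1 - x\<^sub>2\<close> turns its measurement of \<open>x\<^sub>2\<close> into one of \<open>x\<^sub>1\<close>.\<close>

definition joint_step :: "nat \<Rightarrow> (nat \<Rightarrow> nat) \<Rightarrow> l1_step" where
  "joint_step m M = (let a = (\<lambda>k j i.
       if k < M 1 then (if j = 1 \<and> i = k then 1 else 0)
       else (if j = 2 \<and> i = m + (k - M 1) then 1 else 0)) in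
     \<lparr>num_rows = M 1 + (M 2 - m), matrix_coeff = a, data_coeff = a,
      feedback_coeff = (\<lambda>s k j i. if k < M 1 then 0 else a k j i)\<rparr>)"

text \<open>Solution 0 stands for \<open>x 1 - x 2\<close> and solution 1 for \<open>x 1\<close>,
  whence the signs.\<close>

definition shared_rows_algorithm :: "nat \<Rightarrow> (nat \<Rightarrow> nat) \<Rightarrow> l1_algorithm" where
  "shared_rows_algorithm m M = \<lparr>steps = [difference_step m, joint_step m M],
     output_coeff = (\<lambda>j s. if s = 1 then 1 else if j = 1 then 0 else - 1)\<rparr>"

text \<open>For a design with shared rows this lists each sampled row once. For
  \<open>m \<le> M 1\<close> its first \<open>m\<close> rows are the shared ones, so one matrix
  describes both minimization problems.\<close>

definition stacked :: "nat \<Rightarrow> (nat \<Rightarrow> nat) \<Rightarrow> (nat \<Rightarrow> rmat) \<Rightarrow> rmat" where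
  "stacked m M \<Phi> = (\<lambda>(k, n). if k < M 1 then \<Phi> 1 (k, n) else \<Phi> 2 (m + (k - M 1), n))"

section \<open>Execution of the two-step algorithm\<close>

lemma sum_single_coeff:
  "(\<Sum>i<(n::nat). (if i = k then c else 0) * f i) = (if k < n then c * f k else (0 :: real))"
proof -
  have "(\<Sum>i<n. (if i = k then c else 0) * f i) = (\<Sum>i<n. if i = k then c * f i else 0)"
    by (intro sum.cong) auto
  then show ?thesis by simp
qed

lemma combine_eq: "combine M a y = (\<Sum>i<M 1. a 1 i * y 1 i) + (\<Sum>i<M 2. a 2 i * y 2 i)"
  by (simp add: combine_def)

lemma l1_solutions_cong:
  assumes "\<And>i k. i < m \<Longrightarrow> k < n \<Longrightarrow> A (i, k) = B (i, k)"
  shows "l1_solutions m n A y = l1_solutions m n B y"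
proof -
  have "apply_mat m n A v = apply_mat m n B v" for v
    unfolding apply_mat_def using assms by (intro restrict_ext sum.cong) auto
  then show ?thesis by (simp add: l1_solutions_def)
qed

lemma l1_solutions_singletonD:
  assumes "l1_solutions m n A y = {v}"
  shows "v \<in> {..<n} \<rightarrow>\<^sub>E UNIV"
proof -
  have "v \<in> l1_solutions m n A y" unfolding assms by simp
  then show ?thesis unfolding l1_solutions_def by blast
qed

text \<open>Splits the demand for a unique minimizer into consistency of the data and
  recoverability, which are treated separately below.\<close>

lemma l1_solutions_singleton_iff:
  "l1_solutions m n A y = {v} \<longleftrightarrow> apply_mat m n A v = y \<and> l1_recovers m n A v"
proof
  assume *: "l1_solutions m n A y = {v}"
  then have "v \<in> l1_solutions m n A y" by simp
  then have "apply_mat m n A v = y" by (simp add: l1_solutions_def)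
  with * show "apply_mat m n A v = y \<and> l1_recovers m n A v" by (simp add: l1_recovers_def)
qed (auto simp: l1_recovers_def)

lemma step_matrix_difference:
  assumes "i < m" "m \<le> M 1" "m \<le> M 2"
  shows "step_matrix M (difference_step m) \<Phi> (i, k) = stacked m M \<Phi> (i, k)"
  using assms by (simp add: step_matrix_def combine_eq difference_step_def sum_single_coeff stacked_def)

lemma step_matrix_joint:
  assumes "i < M 1 + (M 2 - m)"
  shows "step_matrix M (joint_step m M) \<Phi> (i, k) = stacked m M \<Phi> (i, k)"
  using assms by (auto simp: step_matrix_def combine_eq joint_step_def sum_single_coeff stacked_def Let_def)

lemma step_data_difference:
  assumes "m \<le> M 1" "m \<le> M 2"
  shows "step_data N M (difference_step m) \<Phi> y vs = (\<lambda>k\<in>{..<m}. y 1 k - y 2 k)"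
  unfolding step_data_def
  by (rule ext)
     (use assms in \<open>auto simp: combine_eq difference_step_def sum_single_coeff restrict_def\<close>)

lemma step_data_joint:
  "step_data N M (joint_step m M) \<Phi> y [v] = (\<lambda>k\<in>{..<M 1 + (M 2 - m)}.
     if k < M 1 then y 1 k else y 2 (m + (k - M 1)) + apply_mat (M 2) N (\<Phi> 2) v (m + (k - M 1)))"
  unfolding step_data_def
  by (rule ext)
     (auto simp: combine_eq joint_step_def sum_single_coeff restrict_def Let_def)

text \<open>The first conjunct of the right-hand side says that the shared rows measure \<open>x\<^sub>2\<close>
  alike. It is kept because the event must be measurable in the space of all matrix pairs, not
  only on those with shared rows.\<close>

lemma shared_rows_algorithm_returns_iff:
  fixes x :: "nat \<Rightarrow> rvec"
  assumes x: "x 1 \<in> {..<N} \<rightarrow>\<^sub>E UNIV" "x 2 \<in> {..<N} \<rightarrow>\<^sub>E UNIV" and m: "m \<le> M 1" "m \<le> M 2"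
  shows "l1_algorithm_returns N M (shared_rows_algorithm m M) \<Phi>
      (\<lambda>j. apply_mat (M j) N (\<Phi> j) (x j)) x \<longleftrightarrow>
    (\<forall>i<m. (\<Sum>n<N. (\<Phi> 1 (i, n) - \<Phi> 2 (i, n)) * x 2 n) = 0) \<and>
    l1_recovers m N (stacked m M \<Phi>) (\<lambda>n\<in>{..<N}. x 1 n - x 2 n) \<and>
    l1_recovers (M 1 + (M 2 - m)) N (stacked m M \<Phi>) (x 1)" (is "_ = ?R")
proof -
  let ?A = "stacked m M \<Phi>" and ?m' = "M 1 + (M 2 - m)"
  let ?y = "\<lambda>j. apply_mat (M j) N (\<Phi> j) (x j)"
  define d where "d = (\<lambda>n\<in>{..<N}. x 1 n - x 2 n)"
  have m': "i < m + (M 2 - m) \<longleftrightarrow> i < M 2" for i using m by auto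
  \<comment> \<open>The rows of sensor 1 subtract \<open>\<Phi> 1\<close> applied to
    \<open>x 2\<close>, whereas the data subtract \<open>\<Phi> 2\<close> applied to
    \<open>x 2\<close>; the mismatch is the difference of the first \<open>m\<close> rows applied to
    \<open>x 2\<close>.\<close>
  have data1: "apply_mat m N ?A d = step_data N M (difference_step m) \<Phi> ?y [] \<longleftrightarrow>
      (\<forall>i<m. (\<Sum>n<N. (\<Phi> 1 (i, n) - \<Phi> 2 (i, n)) * x 2 n) = 0)"
  proof -
    have "apply_mat m N ?A d = step_data N M (difference_step m) \<Phi> ?y [] \<longleftrightarrow>
      (\<forall>i<m. (\<Sum>n<N. ?A (i, n) * d n) = ?y 1 i - ?y 2 i)"
      unfolding step_data_difference[where m = m and M = M, OF m] apply_mat_def[of m]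
      by (simp add: restrict_def fun_eq_iff)
    also have "\<dots> \<longleftrightarrow> (\<forall>i<m. (\<Sum>n<N. (\<Phi> 1 (i, n) - \<Phi> 2 (i, n)) * x 2 n) = 0)"
    proof (intro all_cong)
      fix i assume i: "i < m"
      have "(\<Sum>n<N. ?A (i, n) * d n) = (\<Sum>n<N. \<Phi> 1 (i, n) * x 1 n) - (\<Sum>n<N. \<Phi> 1 (i, n) * x 2 n)"
        unfolding sum_subtractf[symmetric] using i m
        by (intro sum.cong) (auto simp: stacked_def d_def right_diff_distrib)
      moreover have "?y 1 i - ?y 2 i = (\<Sum>n<N. \<Phi> 1 (i, n) * x 1 n) - (\<Sum>n<N. \<Phi> 2 (i, n) * x 2 n)"
        using i m by (simp add: apply_mat_def)
      moreover have "(\<Sum>n<N. (\<Phi> 1 (i, n) - \<Phi> 2 (i, n)) * x 2 n)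
          = (\<Sum>n<N. \<Phi> 1 (i, n) * x 2 n) - (\<Sum>n<N. \<Phi> 2 (i, n) * x 2 n)"
        by (simp add: left_diff_distrib sum_subtractf)
      ultimately show "(\<Sum>n<N. ?A (i, n) * d n) = ?y 1 i - ?y 2 i \<longleftrightarrow>
          (\<Sum>n<N. (\<Phi> 1 (i, n) - \<Phi> 2 (i, n)) * x 2 n) = 0" by auto
    qed
    finally show ?thesis .
  qed
  have data2: "step_data N M (joint_step m M) \<Phi> ?y [d] = apply_mat ?m' N ?A (x 1)"
  proof (rule ext)
    fix k
    have *: "(\<Sum>n<N. \<Phi> 2 (i, n) * x 2 n) + (\<Sum>n<N. \<Phi> 2 (i, n) * d n) = (\<Sum>n<N. \<Phi> 2 (i, n) * x 1 n)" for i
      unfolding sum.distrib[symmetric] by (intro sum.cong) (auto simp: d_def algebra_simps)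
    show "step_data N M (joint_step m M) \<Phi> ?y [d] k = apply_mat ?m' N ?A (x 1) k"
      unfolding step_data_joint using m
      by (cases "k < ?m'"; cases "k < M 1") (auto simp: apply_mat_def stacked_def *)
  qed
  have sol1: "l1_solutions m N (step_matrix M (difference_step m) \<Phi>) b = l1_solutions m N ?A b" for b
    by (intro l1_solutions_cong step_matrix_difference m)
  have sol2: "l1_solutions ?m' N (step_matrix M (joint_step m M) \<Phi>) b = l1_solutions ?m' N ?A b" for b
    by (intro l1_solutions_cong step_matrix_joint)
  have rows: "num_rows (difference_step m) = m" "num_rows (joint_step m M) = ?m'"
    by (simp_all add: difference_step_def joint_step_def Let_def)
  have "l1_algorithm_returns N M (shared_rows_algorithm m M) \<Phi> ?y x \<longleftrightarrow>
    (\<exists>v0 v1. l1_solutions m N ?A (step_data N M (difference_step m) \<Phi> ?y []) = {v0} \<and>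
      l1_solutions ?m' N ?A (step_data N M (joint_step m M) \<Phi> ?y [v0]) = {v1} \<and>
      x 1 = (\<lambda>n\<in>{..<N}. v1 n) \<and> x 2 = (\<lambda>n\<in>{..<N}. v1 n - v0 n))" (is "_ \<longleftrightarrow> ?S")
  proof -
    let ?P = "\<lambda>vs. (\<forall>t<length vs.
           l1_solutions (num_rows (steps (shared_rows_algorithm m M) ! t)) N
             (step_matrix M (steps (shared_rows_algorithm m M) ! t) \<Phi>)
             (step_data N M (steps (shared_rows_algorithm m M) ! t) \<Phi> ?y (take t vs)) = {vs ! t}) \<and>
        (\<forall>j\<in>{1, 2}. x j = (\<lambda>n\<in>{..<N}. \<Sum>t<length vs. output_coeff (shared_rows_algorithm m M) j t * (vs ! t) n))"
    have two: "(\<forall>t<length [v0, v1]. Q t) \<longleftrightarrow> Q 0 \<and> Q 1" for Q and v0 v1 :: rvec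
      by (simp add: less_Suc_eq all_conj_distrib numeral_2_eq_2)
    have P: "?P [v0, v1] \<longleftrightarrow> l1_solutions m N ?A (step_data N M (difference_step m) \<Phi> ?y []) = {v0} \<and>
      l1_solutions ?m' N ?A (step_data N M (joint_step m M) \<Phi> ?y [v0]) = {v1} \<and>
      x 1 = (\<lambda>n\<in>{..<N}. v1 n) \<and> x 2 = (\<lambda>n\<in>{..<N}. v1 n - v0 n)" for v0 v1
      unfolding two by (simp add: shared_rows_algorithm_def rows[simplified] sol1 sol2[simplified])
    have "l1_algorithm_returns N M (shared_rows_algorithm m M) \<Phi> ?y x \<longleftrightarrow> (\<exists>vs. length vs = 2 \<and> ?P vs)"
      unfolding l1_algorithm_returns_def by (simp add: shared_rows_algorithm_def numeral_2_eq_2)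
    also have "\<dots> \<longleftrightarrow> (\<exists>v0 v1. ?P [v0, v1])"
    proof
      assume "\<exists>vs. length vs = 2 \<and> ?P vs"
      then obtain vs where vs: "length vs = 2" "?P vs" by blast
      then obtain v0 v1 where "vs = [v0, v1]"
        by (auto simp: numeral_2_eq_2 length_Suc_conv)
      with vs(2) show "\<exists>v0 v1. ?P [v0, v1]" by blast
    next
      assume "\<exists>v0 v1. ?P [v0, v1]"
      then obtain v0 v1 where "?P [v0, v1]" by blast
      moreover have "length [v0, v1] = 2" by simp
      ultimately show "\<exists>vs. length vs = 2 \<and> ?P vs" by blast
    qed
    finally show ?thesis unfolding P .
  qed
  also have "?S \<longleftrightarrow> ?R"
  proof
    assume ?S
    then obtain v0 v1 where v: "l1_solutions m N ?A (step_data N M (difference_step m) \<Phi> ?y []) = {v0}"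
      "l1_solutions ?m' N ?A (step_data N M (joint_step m M) \<Phi> ?y [v0]) = {v1}"
      and out: "x 1 = (\<lambda>n\<in>{..<N}. v1 n)" "x 2 = (\<lambda>n\<in>{..<N}. v1 n - v0 n)" by blast
    \<comment> \<open>Minimizers are extensional, so the output equations determine both of them as
      functions.\<close>
    have "v0 \<in> {..<N} \<rightarrow>\<^sub>E UNIV" "v1 \<in> {..<N} \<rightarrow>\<^sub>E UNIV"
      by (rule l1_solutions_singletonD[OF v(1)], rule l1_solutions_singletonD[OF v(2)])
    then have "v0 = d" "v1 = x 1"
      using out by (auto simp: d_def restrict_def PiE_def extensional_def fun_eq_iff)
    then show ?R using v data1 by (simp add: l1_solutions_singleton_iff data2 d_def)
  next
    assume R: ?R
    have "l1_solutions m N ?A (step_data N M (difference_step m) \<Phi> ?y []) = {d}"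
      unfolding l1_solutions_singleton_iff using R data1 by (simp add: d_def)
    moreover have "l1_solutions ?m' N ?A (step_data N M (joint_step m M) \<Phi> ?y [d]) = {x 1}"
      unfolding l1_solutions_singleton_iff using R data2 by simp
    moreover have "x 1 = (\<lambda>n\<in>{..<N}. x 1 n)" "x 2 = (\<lambda>n\<in>{..<N}. x 1 n - d n)"
      using x by (auto simp: d_def restrict_def PiE_def extensional_def fun_eq_iff)
    ultimately show ?S by blast
  qed
  finally show ?thesis .
qed

text \<open>Distributing the rows of one drawn matrix ensures that stacking gives back an i.i.d.
  Gaussian matrix. The rows from \<open>M 1\<close> on are private to sensor 2.\<close>

definition shared_rows_sampler :: "nat \<Rightarrow> nat \<Rightarrow> (nat \<Rightarrow> nat) \<Rightarrow> rmat \<Rightarrow> nat \<Rightarrow> rmat" where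
  "shared_rows_sampler N m M A = (\<lambda>j\<in>{1, 2}. \<lambda>(i, k)\<in>{..<M j} \<times> {..<N}.
     A (if j = 1 \<or> i < m then i else M 1 + (i - m), k))"

definition shared_rows_design :: "nat \<Rightarrow> nat \<Rightarrow> (nat \<Rightarrow> nat) \<Rightarrow> (nat \<Rightarrow> rmat) measure" where
  "shared_rows_design N m M = distr (gaussian_matrix (M 1 + (M 2 - m)) N)
     (\<Pi>\<^sub>M j\<in>{1, 2}. gaussian_matrix (M j) N) (shared_rows_sampler N m M)"

lemma measurable_shared_rows_sampler:
  assumes "m \<le> M 1" "m \<le> M 2"
  shows "shared_rows_sampler N m M \<in> gaussian_matrix (M 1 + (M 2 - m)) N \<rightarrow>\<^sub>M
    (\<Pi>\<^sub>M j\<in>{1, 2}. gaussian_matrix (M j) N)"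
  unfolding shared_rows_sampler_def
proof (rule measurable_restrict, rule measurable_select_rows)
  fix j i :: nat assume "j \<in> {1, 2}" "i < M j"
  then show "(if j = 1 \<or> i < m then i else M 1 + (i - m)) < M 1 + (M 2 - m)"
    using assms by auto
qed

text \<open>Each sensor sees distinct rows of the drawn matrix, as \<open>m \<le> M 1\<close> keeps
  the reused rows of sensor 2 apart from its private ones. So both marginals are Gaussian despite
  the sharing.\<close>

lemma gaussian_design_shared_rows:
  assumes m: "m \<le> M 1" "m \<le> M 2"
  shows "gaussian_design N M (shared_rows_design N m M)"
  unfolding gaussian_design_def
proof (intro conjI ballI)
  show "sets (shared_rows_design N m M) = sets (\<Pi>\<^sub>M j\<in>{1, 2}. gaussian_matrix (M j) N)"
    by (simp add: shared_rows_design_def)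
  fix j :: nat assume j: "j \<in> {1, 2}"
  define r where "r = (\<lambda>i. if j = 1 \<or> i < m then i else M 1 + (i - m))"
  have "inj_on r {..<M j}" using m by (auto simp: inj_on_def r_def split: if_splits)
  moreover have "r i < M 1 + (M 2 - m)" if "i < M j" for i using that m j by (auto simp: r_def)
  ultimately have "distr (gaussian_matrix (M 1 + (M 2 - m)) N) (gaussian_matrix (M j) N)
     (\<lambda>A. \<lambda>(i, k)\<in>{..<M j} \<times> {..<N}. A (r i, k)) = gaussian_matrix (M j) N"
    by (rule gaussian_matrix_select_rows)
  moreover have "(\<lambda>\<Phi>. \<Phi> j) \<circ> shared_rows_sampler N m M
      = (\<lambda>A. \<lambda>(i, k)\<in>{..<M j} \<times> {..<N}. A (r i, k))"
    using j by (auto simp: shared_rows_sampler_def r_def fun_eq_iff)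
  ultimately show "distr (shared_rows_design N m M) (gaussian_matrix (M j) N) (\<lambda>\<Phi>. \<Phi> j)
      = gaussian_matrix (M j) N"
    unfolding shared_rows_design_def
    by (subst distr_distr[OF measurable_component_singleton[OF j] measurable_shared_rows_sampler[where m = m and M = M, OF m]]) simp
qed

section \<open>Measurability of the recovery event\<close>

lemma jsm1_signal_extensional: "jsm1_signal N z j \<in> {..<N} \<rightarrow>\<^sub>E UNIV"
  by (simp add: jsm1_signal_def)

lemma measurable_jsm1_signal:
  assumes "n < N" "j \<in> {1, 2}"
  shows "(\<lambda>z. jsm1_signal N z j n) \<in> borel_measurable (jsm1 S\<^sub>C S \<sigma> N)"
  using measurable_jsm1_common[OF assms(1), of S\<^sub>C S \<sigma>] measurable_jsm1_innovation[OF assms, of S\<^sub>C S \<sigma>]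
    assms(1) by (simp add: jsm1_signal_def borel_measurable_add)

text \<open>The common component cancels, so only the two innovations contribute to the
  support.\<close>

definition signal_difference :: "nat \<Rightarrow> rvec \<times> (nat \<Rightarrow> rvec) \<Rightarrow> rvec" where
  "signal_difference N z = (\<lambda>n\<in>{..<N}. jsm1_signal N z 1 n - jsm1_signal N z 2 n)"

lemma signal_difference_extensional: "signal_difference N z \<in> {..<N} \<rightarrow>\<^sub>E UNIV"
  by (simp add: signal_difference_def)

lemma measurable_signal_difference:
  assumes "n < N"
  shows "(\<lambda>z. signal_difference N z n) \<in> borel_measurable (jsm1 S\<^sub>C S \<sigma> N)"
  using measurable_jsm1_signal[OF assms, of 1 S\<^sub>C S \<sigma>] measurable_jsm1_signal[OF assms, of 2 S\<^sub>C S \<sigma>]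
    assms by (simp add: signal_difference_def borel_measurable_diff)

lemma recovery_event_shared_rows:
  assumes "m \<le> M 1" "m \<le> M 2"
  shows "(z, \<Phi>) \<in> recovery_event N M (shared_rows_algorithm m M) \<longleftrightarrow>
    (\<forall>i<m. (\<Sum>n<N. (\<Phi> 1 (i, n) - \<Phi> 2 (i, n)) * jsm1_signal N z 2 n) = 0) \<and>
    l1_recovers m N (stacked m M \<Phi>) (signal_difference N z) \<and>
    l1_recovers (M 1 + (M 2 - m)) N (stacked m M \<Phi>) (jsm1_signal N z 1)"
  unfolding recovery_event_def mem_Collect_eq prod.case signal_difference_def
  by (intro shared_rows_algorithm_returns_iff jsm1_signal_extensional assms)

text \<open>A set outside \<open>sets P\<close> has measure 0 by convention, so the probability
  bound rests on this. The three conditions of the criterion are measurable one by one.\<close>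

lemma sets_recovery_event_shared_rows:
  fixes M :: "nat \<Rightarrow> nat" and N m :: nat and S\<^sub>C \<sigma> :: real and S :: "nat \<Rightarrow> real"
  assumes m: "m \<le> M 1" "m \<le> M 2"
  defines "P \<equiv> jsm1 S\<^sub>C S \<sigma> N \<Otimes>\<^sub>M (\<Pi>\<^sub>M j\<in>{1, 2}. gaussian_matrix (M j) N)"
  shows "recovery_event N M (shared_rows_algorithm m M) \<inter> space P \<in> sets P"
proof -
  have \<Phi>: "(\<lambda>q. snd q j (i, n)) \<in> borel_measurable P" if "j \<in> {1, 2}" "i < M j" "n < N" for i j n
    unfolding P_def
    by (rule measurable_compose[OF measurable_snd],
        rule measurable_compose[OF measurable_component_singleton[OF that(1)]],
        rule measurable_gaussian_matrix_component[OF that(2,3)])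
  have z: "(\<lambda>q. f (fst q)) \<in> borel_measurable P" if "f \<in> borel_measurable (jsm1 S\<^sub>C S \<sigma> N)" for f :: "_ \<Rightarrow> real"
    unfolding P_def by (rule measurable_compose[OF measurable_fst that])
  have A: "(\<lambda>q. stacked m M (snd q) (i, n)) \<in> borel_measurable P"
    if "i < M 1 + (M 2 - m)" "n < N" for i n
    using \<Phi>[of 1 i n] \<Phi>[of 2 "m + (i - M 1)" n] that m
    by (cases "i < M 1") (simp_all add: stacked_def)
  have 1: "{q \<in> space P. \<forall>i<m. (\<Sum>n<N. (snd q 1 (i, n) - snd q 2 (i, n)) * jsm1_signal N (fst q) 2 n) = 0} \<in> sets P"
  proof -
    have meas: "(\<lambda>q. \<Sum>n<N. (snd q 1 (i, n) - snd q 2 (i, n)) * jsm1_signal N (fst q) 2 n) \<in> borel_measurable P"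
      if "i < m" for i
      using that m
      by (intro borel_measurable_sum borel_measurable_times borel_measurable_diff \<Phi> z measurable_jsm1_signal) auto
    have "{q \<in> space P. (\<Sum>n<N. (snd q 1 (i, n) - snd q 2 (i, n)) * jsm1_signal N (fst q) 2 n) = 0} \<in> sets P"
      if "i < m" for i
      using meas[OF that] by measurable
    then have "{q \<in> space P. \<forall>i\<in>{..<m}. (\<Sum>n<N. (snd q 1 (i, n) - snd q 2 (i, n)) * jsm1_signal N (fst q) 2 n) = 0} \<in> sets P"
      by (intro sets.sets_Collect_finite_All) (simp_all only: lessThan_iff finite_lessThan)
    then show ?thesis by (simp only: Ball_def lessThan_iff)
  qed
  have 2: "{q \<in> space P. l1_recovers m N (stacked m M (snd q)) (signal_difference N (fst q))} \<in> sets P"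
    using m by (intro measurable_l1_recovers A z measurable_signal_difference signal_difference_extensional) auto
  have 3: "{q \<in> space P. l1_recovers (M 1 + (M 2 - m)) N (stacked m M (snd q)) (jsm1_signal N (fst q) 1)} \<in> sets P"
    by (intro measurable_l1_recovers A z measurable_jsm1_signal jsm1_signal_extensional) auto
  have "recovery_event N M (shared_rows_algorithm m M) \<inter> space P =
      {q \<in> space P. \<forall>i<m. (\<Sum>n<N. (snd q 1 (i, n) - snd q 2 (i, n)) * jsm1_signal N (fst q) 2 n) = 0} \<inter>
      {q \<in> space P. l1_recovers m N (stacked m M (snd q)) (signal_difference N (fst q))} \<inter>
      {q \<in> space P. l1_recovers (M 1 + (M 2 - m)) N (stacked m M (snd q)) (jsm1_signal N (fst q) 1)}"
    (is "_ = ?R")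
  proof (rule set_eqI)
    fix q
    show "q \<in> recovery_event N M (shared_rows_algorithm m M) \<inter> space P \<longleftrightarrow> q \<in> ?R"
      using recovery_event_shared_rows[where m = m and M = M, OF m, of "fst q" "snd q" N]
      unfolding prod.collapse by blast
  qed
  then show ?thesis by (simp only:) (intro sets.Int 1 2 3)
qed

lemma shared_rows_sampler_agree:
  assumes "i < m" "n < N" "m \<le> M 1" "m \<le> M 2"
  shows "shared_rows_sampler N m M A 1 (i, n) = shared_rows_sampler N m M A 2 (i, n)"
  using assms by (simp add: shared_rows_sampler_def)

text \<open>Stacking undoes the sampling: from \<open>M 1\<close> on, row \<open>i\<close> is row
  \<open>m + (i - M 1)\<close> of sensor 2, which was drawn as row \<open>i\<close>.\<close>

lemma stacked_shared_rows_sampler: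
  assumes "i < M 1 + (M 2 - m)" "n < N" "m \<le> M 1" "m \<le> M 2"
  shows "stacked m M (shared_rows_sampler N m M A) (i, n) = A (i, n)"
  using assms by (auto simp: stacked_def shared_rows_sampler_def)

text \<open>Union bound over the two minimization problems. Each contributes a Chebyshev term for an
  oversized support and a \<open>\<delta>\<close> for failure on a fixed signal. The row counts
  \<open>m1\<close> and \<open>m2\<close>, for which the fixed-signal bound is known, are dominated
  by those available.\<close>

lemma recovery_probability_shared_rows:
  fixes M :: "nat \<Rightarrow> nat" and S\<^sub>C S\<^sub>I \<sigma> S1 S2 \<delta> :: real
  assumes \<sigma>: "\<sigma> > 0" and SC: "0 \<le> S\<^sub>C" "S\<^sub>C \<le> 1" and SI: "0 \<le> S\<^sub>I" "S\<^sub>I \<le> 1"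
    and N: "N > 0" and m: "m \<le> M 1" "m \<le> M 2" and \<delta>: "\<delta> \<ge> 0"
    and S1: "1 - (1 - S\<^sub>I)\<^sup>2 < S1" "S1 < 1"
    and S2: "1 - (1 - S\<^sub>C) * (1 - S\<^sub>I)\<^sup>2 < S2" "S2 < 1"
    and m1: "m1 \<le> m" "\<And>w. w \<in> sparse_vectors (nat \<lfloor>S1 * real N\<rfloor>) N \<Longrightarrow> l1_recovery_prob m1 N w > 1 - \<delta>"
    and m2: "m2 \<le> M 1 + (M 2 - m)"
      "\<And>w. w \<in> sparse_vectors (nat \<lfloor>S2 * real N\<rfloor>) N \<Longrightarrow> l1_recovery_prob m2 N w > 1 - \<delta>"
  defines "P \<equiv> jsm1 S\<^sub>C (\<lambda>j. S\<^sub>I) \<sigma> N \<Otimes>\<^sub>M shared_rows_design N m M"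
  shows "prob_space P"
    and "measure P (recovery_event N M (shared_rows_algorithm m M) \<inter> space P) \<ge>
      1 - (1 / (real N * (S1 - (1 - (1 - S\<^sub>I)\<^sup>2))\<^sup>2)
         + 1 / (real N * (S2 - (1 - (1 - S\<^sub>C) * (1 - S\<^sub>I)\<^sup>2))\<^sup>2) + 2 * \<delta>)"
proof -
  define J where "J = jsm1 S\<^sub>C (\<lambda>j. S\<^sub>I) \<sigma> N"
  define m' where "m' = M 1 + (M 2 - m)"
  define G where "G = gaussian_matrix m' N"
  define W where "W = (\<Pi>\<^sub>M j\<in>{1, 2}. gaussian_matrix (M j) N)"
  define T where "T = shared_rows_sampler N m M"
  define E where "E = recovery_event N M (shared_rows_algorithm m M) \<inter> space (J \<Otimes>\<^sub>M W)"
  have J: "prob_space J" unfolding J_def by (rule prob_space_jsm1[OF \<sigma>])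
  have G: "prob_space G" unfolding G_def by (rule prob_space_gaussian_matrix)
  interpret JG: prob_space "J \<Otimes>\<^sub>M G" by (intro prob_space_pair J G)
  have T: "T \<in> G \<rightarrow>\<^sub>M W"
    unfolding T_def G_def W_def m'_def by (rule measurable_shared_rows_sampler[where m = m and M = M, OF m])
  have D: "shared_rows_design N m M = distr G W T"
    by (simp add: shared_rows_design_def G_def W_def T_def m'_def)
  have DP: "prob_space (distr G W T)" by (rule prob_space.prob_space_distr[OF G T])
  show "prob_space P" unfolding P_def D J_def[symmetric] by (intro prob_space_pair J DP)
  interpret D: prob_space "distr G W T" by (rule DP)
  \<comment> \<open>The design is the image of one Gaussian matrix, so probabilities are computed
    for pairs of a signal and that matrix.\<close>
  have P: "P = distr (J \<Otimes>\<^sub>M G) (J \<Otimes>\<^sub>M W) (\<lambda>(z, A). (z, T A))"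
    using pair_measure_distr[OF measurable_ident T D.sigma_finite_measure_axioms, of J]
    by (simp add: P_def D J_def[symmetric] id_def)
  have g: "(\<lambda>(z, A). (z, T A)) \<in> J \<Otimes>\<^sub>M G \<rightarrow>\<^sub>M J \<Otimes>\<^sub>M W"
    using T by measurable
  have sP: "space P = space (J \<Otimes>\<^sub>M W)" by (simp add: P)
  have E: "E \<in> sets (J \<Otimes>\<^sub>M W)"
    unfolding E_def J_def W_def by (rule sets_recovery_event_shared_rows[where m = m and M = M, OF m])

  define K1 where "K1 = nat \<lfloor>S1 * real N\<rfloor>"
  define K2 where "K2 = nat \<lfloor>S2 * real N\<rfloor>"
  define B1 where "B1 = {z \<in> space J. real (card {n \<in> {..<N}.
      \<not> ((False \<longrightarrow> fst z n = 0) \<and> snd z 1 n = 0 \<and> snd z 2 n = 0)}) \<ge> S1 * real N}"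
  define B2 where "B2 = {z \<in> space J. real (card {n \<in> {..<N}.
      \<not> ((True \<longrightarrow> fst z n = 0) \<and> snd z 1 n = 0 \<and> snd z 2 n = 0)}) \<ge> S2 * real N}"
  have B1: "B1 \<in> sets J" "measure J B1 \<le> 1 / (real N * (S1 - (1 - (1 - S\<^sub>I)\<^sup>2))\<^sup>2)"
    unfolding B1_def J_def
    by (rule jsm1_support_concentration[where b = False and S = "1 - (1 - S\<^sub>I)\<^sup>2", OF \<sigma> SC SI _ S1(1) N], simp)+
  have B2: "B2 \<in> sets J" "measure J B2 \<le> 1 / (real N * (S2 - (1 - (1 - S\<^sub>C) * (1 - S\<^sub>I)\<^sup>2))\<^sup>2)"
    unfolding B2_def J_def
    by (rule jsm1_support_concentration[where b = True and S = "1 - (1 - S\<^sub>C) * (1 - S\<^sub>I)\<^sup>2", OF \<sigma> SC SI _ S2(1) N], simp)+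
  \<comment> \<open>A cardinality is an integer, so exceeding the rounded-down bound means exceeding
    \<open>s * real N\<close> itself.\<close>
  have big: "s * real N \<le> real (card Y)"
    if "nat \<lfloor>s * real N\<rfloor> < card X" "X \<subseteq> Y" "Y \<subseteq> {..<N}" for s X Y
  proof -
    have "card X \<le> card Y" using that by (intro card_mono) (auto dest: finite_subset)
    with that(1) have "s * real N < real (card Y)" by linarith
    then show ?thesis by simp
  qed
  have supp1: "z \<in> B1" if "z \<in> space J" "K1 < card {n \<in> {..<N}. signal_difference N z n \<noteq> 0}" for z
    unfolding B1_def mem_Collect_eq using that(1)
    by (intro conjI big[OF that(2)[unfolded K1_def]])
      (auto simp: signal_difference_def jsm1_signal_def)
  have supp2: "z \<in> B2" if "z \<in> space J" "K2 < card {n \<in> {..<N}. jsm1_signal N z 1 n \<noteq> 0}" for z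
    unfolding B2_def mem_Collect_eq using that(1)
    by (intro conjI big[OF that(2)[unfolded K2_def]]) (auto simp: jsm1_signal_def)
  have mm': "m \<le> m'" using m by (simp add: m'_def)
  define F1 where "F1 = {q \<in> space (J \<Otimes>\<^sub>M G). \<not> l1_recovers m N (snd q) (signal_difference N (fst q))}"
  define F2 where "F2 = {q \<in> space (J \<Otimes>\<^sub>M G). \<not> l1_recovers m' N (snd q) (jsm1_signal N (fst q) 1)}"
  have K: "K1 \<le> N" "K2 \<le> N" unfolding K1_def K2_def using S1(2) S2(2) by (auto intro!: nat_floor_mult_le)
  have v1: "(\<lambda>z. signal_difference N z k) \<in> borel_measurable J" if "k < N" for k
    unfolding J_def using that by (rule measurable_signal_difference)
  have v2: "(\<lambda>z. jsm1_signal N z 1 k) \<in> borel_measurable J" if "k < N" for k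
    unfolding J_def using that by (intro measurable_jsm1_signal) auto
  note failure1 = recovery_failure_random_signal[OF J v1 signal_difference_extensional B1(1) supp1
      K(1) m1(1) mm' \<delta> m1(2)[folded K1_def]]
  note failure2 = recovery_failure_random_signal[OF J v2 jsm1_signal_extensional B2(1) supp2
      K(2) m2(1)[folded m'_def] order_refl \<delta> m2(2)[folded K2_def]]
  have F1: "F1 \<in> sets (J \<Otimes>\<^sub>M G)" "measure (J \<Otimes>\<^sub>M G) F1 \<le> measure J B1 + \<delta>"
    unfolding F1_def G_def by (rule failure1; assumption)+
  have F2: "F2 \<in> sets (J \<Otimes>\<^sub>M G)" "measure (J \<Otimes>\<^sub>M G) F2 \<le> measure J B2 + \<delta>"
    unfolding F2_def G_def by (rule failure2; assumption)+
  \<comment> \<open>On sampled designs the shared rows agree, so the consistency condition is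
    automatic and both recoveries refer to the drawn matrix.\<close>
  have sub: "space (J \<Otimes>\<^sub>M G) - (F1 \<union> F2) \<subseteq> (\<lambda>(z, A). (z, T A)) -` E \<inter> space (J \<Otimes>\<^sub>M G)"
  proof
    fix q assume q: "q \<in> space (J \<Otimes>\<^sub>M G) - (F1 \<union> F2)"
    obtain z A where [simp]: "q = (z, A)" by (cases q)
    have "l1_recovers m N (stacked m M (T A)) (signal_difference N z) \<longleftrightarrow>
        l1_recovers m N A (signal_difference N z)"
      using m by (intro l1_recovers_cong signal_difference_extensional)
        (auto simp: T_def stacked_shared_rows_sampler)
    moreover have "l1_recovers m' N (stacked m M (T A)) (jsm1_signal N z 1) \<longleftrightarrow>
        l1_recovers m' N A (jsm1_signal N z 1)"
      using m by (intro l1_recovers_cong jsm1_signal_extensional)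
        (auto simp: T_def stacked_shared_rows_sampler m'_def)
    moreover have "(\<Sum>n<N. (T A 1 (i, n) - T A 2 (i, n)) * jsm1_signal N z 2 n) = 0" if "i < m" for i
      using shared_rows_sampler_agree[OF that, of _ N M A] m by (intro sum.neutral) (simp add: T_def)
    ultimately have "(z, T A) \<in> recovery_event N M (shared_rows_algorithm m M)"
      using q unfolding recovery_event_shared_rows[where m = m and M = M, OF m]
      by (simp add: F1_def F2_def m'_def)
    moreover have "(z, T A) \<in> space (J \<Otimes>\<^sub>M W)" using q measurable_space[OF g, of q] by simp
    ultimately show "q \<in> (\<lambda>(z, A). (z, T A)) -` E \<inter> space (J \<Otimes>\<^sub>M G)"
      using q by (simp add: E_def)
  qed
  have "1 - (measure J B1 + \<delta> + (measure J B2 + \<delta>)) \<le> 1 - (measure (J \<Otimes>\<^sub>M G) F1 + measure (J \<Otimes>\<^sub>M G) F2)"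
    using F1(2) F2(2) by simp
  also have "\<dots> \<le> 1 - measure (J \<Otimes>\<^sub>M G) (F1 \<union> F2)"
    using measure_Un_le[OF F1(1) F2(1)] by simp
  also have "\<dots> = measure (J \<Otimes>\<^sub>M G) (space (J \<Otimes>\<^sub>M G) - (F1 \<union> F2))"
    using F1(1) F2(1) by (subst JG.prob_compl) auto
  also have "\<dots> \<le> measure (J \<Otimes>\<^sub>M G) ((\<lambda>(z, A). (z, T A)) -` E \<inter> space (J \<Otimes>\<^sub>M G))"
    by (intro JG.finite_measure_mono sub measurable_sets[OF g E])
  also have "\<dots> = measure P E" unfolding P by (rule measure_distr[OF g E, symmetric])
  finally show "measure P (recovery_event N M (shared_rows_algorithm m M) \<inter> space P) \<ge>
      1 - (1 / (real N * (S1 - (1 - (1 - S\<^sub>I)\<^sup>2))\<^sup>2)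
         + 1 / (real N * (S2 - (1 - (1 - S\<^sub>C) * (1 - S\<^sub>I)\<^sup>2))\<^sup>2) + 2 * \<delta>)"
    using B1(2) B2(2) unfolding sP E_def by linarith
qed

section \<open>Rates\<close>

text \<open>Continuity from the right provides the slack: \<open>S'\<close> above \<open>S\<close>
  absorbs the fluctuation of the support, \<open>\<epsilon>\<close> the margin above the threshold.
  At \<open>S = 0\<close>, where the rate is 0 by its definition, the limit \<open>zero\<close>
  takes the place of continuity.\<close>

lemma overmeasuring_rate_margin:
  assumes cont: "continuous_on {0<..<1} (overmeasuring_rate c)"
    and zero: "(overmeasuring_rate c \<longlongrightarrow> 0) (at_right 0)"
    and S: "0 \<le> S" "S < 1" and r: "overmeasuring_rate c S < r"
  obtains S' \<epsilon> where "S < S'" "S' < 1" "\<epsilon> > 0" "(c S' + \<epsilon>) * S' < r"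
proof -
  have lim: "(overmeasuring_rate c \<longlongrightarrow> overmeasuring_rate c S) (at_right S)"
  proof (cases "S = 0")
    case True
    then show ?thesis using zero by (simp add: overmeasuring_rate_def)
  next
    case False
    then have "isCont (overmeasuring_rate c) S"
      using S by (intro continuous_on_interior[OF cont]) simp
    then show ?thesis unfolding isCont_def by (rule filterlim_mono) (simp_all add: at_le)
  qed
  have "\<forall>\<^sub>F s in at_right S. overmeasuring_rate c s < r \<and> s \<in> {S<..<1}"
    using order_tendstoD(2)[OF lim r] eventually_at_right_real[OF S(2)] by (rule eventually_conj)
  then obtain S' where S': "overmeasuring_rate c S' < r" "S < S'" "S' < 1"
    using eventually_happens'[OF trivial_limit_at_right_real] by force
  \<comment> \<open>Half of the remaining gap, divided by the factor \<open>S'\<close> that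
    multiplies it again.\<close>
  define \<epsilon> where "\<epsilon> = (r - overmeasuring_rate c S') / (2 * S')"
  have "(c S' + \<epsilon>) * S' = overmeasuring_rate c S' + (r - overmeasuring_rate c S') / 2"
    using S S' by (simp add: \<epsilon>_def overmeasuring_rate_def distrib_right)
  also have "\<dots> < r" using S'(1) by (simp add: field_simps)
  finally have "(c S' + \<epsilon>) * S' < r" .
  moreover have "\<epsilon> > 0" using S S' by (simp add: \<epsilon>_def)
  ultimately show thesis using that S' by blast
qed

text \<open>Rounding the sparsity down costs at most \<open>a\<close> rows and rounding up adds at
  most one; both vanish after division by \<open>N\<close>.\<close>

lemma tendsto_rounded_rate:
  fixes a S :: real
  assumes "a \<ge> 0" "S \<ge> 0"
  shows "(\<lambda>N. real (nat \<lceil>a * real (nat \<lfloor>S * real N\<rfloor>)\<rceil>) / real N) \<longlonglongrightarrow> a * S"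
proof (rule tendsto_sandwich)
  have bounds: "a * S * N - a \<le> real (nat \<lceil>a * real (nat \<lfloor>S * real N\<rfloor>)\<rceil>)"
    "real (nat \<lceil>a * real (nat \<lfloor>S * real N\<rfloor>)\<rceil>) \<le> a * S * N + 1" for N :: nat
  proof -
    have "0 \<le> S * real N" using assms by simp
    then have fl: "S * real N - 1 \<le> real (nat \<lfloor>S * real N\<rfloor>)" "real (nat \<lfloor>S * real N\<rfloor>) \<le> S * real N"
      by linarith+
    have "a * (S * real N - 1) \<le> a * real (nat \<lfloor>S * real N\<rfloor>)"
      "a * real (nat \<lfloor>S * real N\<rfloor>) \<le> a * (S * real N)" "0 \<le> a * real (nat \<lfloor>S * real N\<rfloor>)"
      using assms(1) fl by (simp_all add: mult_left_mono)
    then show "a * S * N - a \<le> real (nat \<lceil>a * real (nat \<lfloor>S * real N\<rfloor>)\<rceil>)"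
      "real (nat \<lceil>a * real (nat \<lfloor>S * real N\<rfloor>)\<rceil>) \<le> a * S * N + 1"
      by (simp_all add: algebra_simps) linarith+
  qed
  show "\<forall>\<^sub>F N in sequentially. a * S - a / real N \<le> real (nat \<lceil>a * real (nat \<lfloor>S * real N\<rfloor>)\<rceil>) / real N"
    using eventually_gt_at_top[of "0::nat"]
  proof eventually_elim
    case (elim N)
    then have "a * S - a / real N = (a * S * real N - a) / real N" by (simp add: field_simps)
    then show ?case using divide_right_mono[OF bounds(1)[of N], of "real N"] by simp
  qed
  show "\<forall>\<^sub>F N in sequentially. real (nat \<lceil>a * real (nat \<lfloor>S * real N\<rfloor>)\<rceil>) / real N \<le> a * S + 1 / real N"
    using eventually_gt_at_top[of "0::nat"]
  proof eventually_elim
    case (elim N)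
    then have "a * S + 1 / real N = (a * S * real N + 1) / real N" by (simp add: field_simps)
    then show ?case using divide_right_mono[OF bounds(2)[of N], of "real N"] by simp
  qed
  show "(\<lambda>N. a * S - a / real N) \<longlonglongrightarrow> a * S"
    using tendsto_diff[OF tendsto_const lim_const_over_n[of a], of "a * S"] by simp
  show "(\<lambda>N. a * S + 1 / real N) \<longlonglongrightarrow> a * S"
    using tendsto_add[OF tendsto_const lim_const_over_n[of "1::real"], of "a * S"] by simp
qed

text \<open>The design requires at least \<open>m N\<close> rows for every \<open>N\<close>, not
  only for large ones. The maximum enforces this and keeps the rate \<open>R\<close> because
  \<open>r \<le> R\<close>.\<close>

lemma tendsto_max_rows:
  fixes m :: "nat \<Rightarrow> nat" and r R :: real
  assumes m: "(\<lambda>N. real (m N) / real N) \<longlonglongrightarrow> r" and R: "0 \<le> R" "r \<le> R"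
  shows "(\<lambda>N. real (max (m N) (nat \<lfloor>R * real N\<rfloor>)) / real N) \<longlonglongrightarrow> R"
proof -
  have "(\<lambda>N. real (nat \<lfloor>R * real N\<rfloor>) / real N) \<longlonglongrightarrow> R"
    using tendsto_rounded_rate[of 1 R] R by simp
  from tendsto_max[OF m this] R(2)
  have "(\<lambda>N. max (real (m N) / real N) (real (nat \<lfloor>R * real N\<rfloor>) / real N)) \<longlonglongrightarrow> R" by (simp add: max_def)
  also have "(\<lambda>N. max (real (m N) / real N) (real (nat \<lfloor>R * real N\<rfloor>) / real N))
      = (\<lambda>N. real (max (m N) (nat \<lfloor>R * real N\<rfloor>)) / real N)"
    by (auto simp: fun_eq_iff max_def divide_right_mono divide_le_cancel)
  finally show ?thesis .
qed

text \<open>As \<open>s\<close> decreases to 0, \<open>2 * s - s\<^sup>2\<close> approaches 0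
  through positive values, so the first term vanishes by \<open>zero\<close>. The second follows by
  continuity at \<open>S\<close>.\<close>

lemma sum_rate_limit:
  fixes f :: "real \<Rightarrow> real"
  assumes cont: "continuous_on {0<..<1} f" and zero: "(f \<longlongrightarrow> 0) (at_right 0)" and f0: "f 0 = 0"
    and S: "0 \<le> S" "S < 1"
  shows "((\<lambda>s. f (2 * s - s\<^sup>2) + f (S + 2 * s - 2 * S * s - s\<^sup>2 + S * s\<^sup>2)) \<longlongrightarrow> f S) (at_right 0)"
proof -
  have "((\<lambda>s::real. 2 * s - s\<^sup>2) \<longlongrightarrow> 2 * 0 - 0\<^sup>2) (at_right 0)" by (intro tendsto_intros)
  moreover have "\<forall>\<^sub>F s::real in at_right 0. 2 * s - s\<^sup>2 > 0"
    using eventually_at_right_real[of 0 "1::real"]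
  proof (rule eventually_mono)
    fix s :: real assume "s \<in> {0<..<1}"
    then have "0 < s * (2 - s)" by (intro mult_pos_pos) auto
    then show "2 * s - s\<^sup>2 > 0" by (simp add: power2_eq_square algebra_simps)
  qed simp
  ultimately have "filterlim (\<lambda>s::real. 2 * s - s\<^sup>2) (at_right 0) (at_right 0)"
    by (auto simp: filterlim_at elim: eventually_mono)
  from filterlim_compose[OF zero this]
  have inn: "((\<lambda>s. f (2 * s - s\<^sup>2)) \<longlongrightarrow> 0) (at_right 0)" .
  have "((\<lambda>s. f (S + 2 * s - 2 * S * s - s\<^sup>2 + S * s\<^sup>2)) \<longlongrightarrow> f S) (at_right 0)"
  proof (cases "S = 0")
    \<comment> \<open>Here \<open>S\<close> is no interior point, but the second argument reduces to
      \<open>2 * s - s\<^sup>2\<close> too.\<close>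
    case True
    then show ?thesis using inn f0 by simp
  next
    case False
    then have "isCont f S"
      using S by (intro continuous_on_interior[OF cont]) simp
    moreover have "((\<lambda>s. S + 2 * s - 2 * S * s - s\<^sup>2 + S * s\<^sup>2) \<longlongrightarrow> S + 2 * 0 - 2 * S * 0 - 0\<^sup>2 + S * 0\<^sup>2) (at_right 0)"
      by (intro tendsto_intros)
    ultimately show ?thesis by (intro isCont_tendsto_compose[of S f]) auto
  qed
  from tendsto_add[OF inn this] show ?thesis by simp
qed

section \<open>Choice of the rates and passage to the limit\<close>

theorem theorem6:
  fixes c c' :: "real \<Rightarrow> real" and \<sigma> S\<^sub>C S\<^sub>I :: real and R :: "nat \<Rightarrow> real"
  defines "c' \<equiv> overmeasuring_rate c"
  assumes c: "overmeasuring_factor c"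
    and c'_cont: "continuous_on {0<..<1} c'"
    and c'_concave: "concave_on {0<..<1} c'"
    and c'_0: "(c' \<longlongrightarrow> 0) (at_right 0)"
    and \<sigma>: "\<sigma> > 0"
    and S\<^sub>C: "0 \<le> S\<^sub>C" "S\<^sub>C < 1"
    and S\<^sub>I: "0 \<le> S\<^sub>I" "S\<^sub>I < 1"
  shows "((\<forall>j\<in>{1, 2}. R j > c' (2 * S\<^sub>I - S\<^sub>I\<^sup>2)) \<and>
          R 1 + R 2 > c' (2 * S\<^sub>I - S\<^sub>I\<^sup>2) +
                      c' (S\<^sub>C + 2 * S\<^sub>I - 2 * S\<^sub>C * S\<^sub>I - S\<^sub>I\<^sup>2 + S\<^sub>C * S\<^sub>I\<^sup>2)
          \<longrightarrow>
          (\<exists>(M :: nat \<Rightarrow> nat \<Rightarrow> nat) (D :: nat \<Rightarrow> (nat \<Rightarrow> rmat) measure)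
             (alg :: nat \<Rightarrow> l1_algorithm) (T :: nat).
             (\<forall>j\<in>{1, 2}. (\<lambda>N. real (M N j) / real N) \<longlonglongrightarrow> R j) \<and>
             (\<forall>N. gaussian_design N (M N) (D N)) \<and>
             (\<forall>N. length (steps (alg N)) = T) \<and>
             (\<lambda>N. measure (jsm1 S\<^sub>C (\<lambda>j. S\<^sub>I) \<sigma> N \<Otimes>\<^sub>M D N)
                    (recovery_event N (M N) (alg N) \<inter>
                     space (jsm1 S\<^sub>C (\<lambda>j. S\<^sub>I) \<sigma> N \<Otimes>\<^sub>M D N))) \<longlonglongrightarrow> 1)) \<and>
         ((\<lambda>s. c' (2 * s - s\<^sup>2) +
               c' (S\<^sub>C + 2 * s - 2 * S\<^sub>C * s - s\<^sup>2 + S\<^sub>C * s\<^sup>2)) \<longlongrightarrow> c' S\<^sub>C) (at_right 0)"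
proof (intro conjI impI)
  have c'0: "c' 0 = 0" by (simp add: c'_def overmeasuring_rate_def)
  show "((\<lambda>s. c' (2 * s - s\<^sup>2) +
      c' (S\<^sub>C + 2 * s - 2 * S\<^sub>C * s - s\<^sup>2 + S\<^sub>C * s\<^sup>2)) \<longlongrightarrow> c' S\<^sub>C) (at_right 0)"
    by (rule sum_rate_limit[OF c'_cont c'_0 c'0 S\<^sub>C])
next
  define s\<^sub>1 where "s\<^sub>1 = 1 - (1 - S\<^sub>I)\<^sup>2"
  define s\<^sub>2 where "s\<^sub>2 = 1 - (1 - S\<^sub>C) * (1 - S\<^sub>I)\<^sup>2"
  have s_eq: "2 * S\<^sub>I - S\<^sub>I\<^sup>2 = s\<^sub>1"
    "S\<^sub>C + 2 * S\<^sub>I - 2 * S\<^sub>C * S\<^sub>I - S\<^sub>I\<^sup>2 + S\<^sub>C * S\<^sub>I\<^sup>2 = s\<^sub>2"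
    by (simp_all add: s\<^sub>1_def s\<^sub>2_def power2_eq_square algebra_simps)
  assume "(\<forall>j\<in>{1, 2}. R j > c' (2 * S\<^sub>I - S\<^sub>I\<^sup>2)) \<and>
    R 1 + R 2 > c' (2 * S\<^sub>I - S\<^sub>I\<^sup>2) + c' (S\<^sub>C + 2 * S\<^sub>I - 2 * S\<^sub>C * S\<^sub>I - S\<^sub>I\<^sup>2 + S\<^sub>C * S\<^sub>I\<^sup>2)"
  then have R: "c' s\<^sub>1 < R 1" "c' s\<^sub>1 < R 2" "c' s\<^sub>1 + c' s\<^sub>2 < R 1 + R 2"
    unfolding s_eq by auto
  have s: "0 \<le> s\<^sub>1" "s\<^sub>1 < 1" "0 \<le> s\<^sub>2" "s\<^sub>2 < 1"
  proof -
    have I: "(1 - S\<^sub>I)\<^sup>2 \<le> 1" "0 < (1 - S\<^sub>I)\<^sup>2" using S\<^sub>I by (simp_all add: power_le_one)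
    then show "0 \<le> s\<^sub>1" "s\<^sub>1 < 1" by (simp_all add: s\<^sub>1_def)
    have "(1 - S\<^sub>C) * (1 - S\<^sub>I)\<^sup>2 \<le> 1 * 1" using I S\<^sub>C by (intro mult_mono) auto
    then show "0 \<le> s\<^sub>2" by (simp add: s\<^sub>2_def)
    show "s\<^sub>2 < 1" using I S\<^sub>C by (simp add: s\<^sub>2_def)
  qed
  note margin = overmeasuring_rate_margin[OF c'_cont[unfolded c'_def] c'_0[unfolded c'_def], folded c'_def]
  \<comment> \<open>The number of shared rows is fixed first. Its rate must stay below
    \<open>R 1\<close> and \<open>R 2\<close> and leave more than \<open>c' s\<^sub>2\<close> for
    the stacked matrix; the minimum encodes all three. Then \<open>S2\<close> and
    \<open>\<epsilon>2\<close> are fitted to what remains.\<close>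
  have "c' s\<^sub>1 < min (min (R 1) (R 2)) (R 1 + R 2 - c' s\<^sub>2)" using R by simp
  then obtain S1 \<epsilon>1 where S1: "s\<^sub>1 < S1" "S1 < 1" "\<epsilon>1 > 0"
    "(c S1 + \<epsilon>1) * S1 < min (min (R 1) (R 2)) (R 1 + R 2 - c' s\<^sub>2)"
    by (rule margin[OF s(1,2)])
  define r where "r = (c S1 + \<epsilon>1) * S1"
  have "c' s\<^sub>2 < R 1 + R 2 - r" using S1(4) by (simp add: r_def)
  then obtain S2 \<epsilon>2 where S2: "s\<^sub>2 < S2" "S2 < 1" "\<epsilon>2 > 0" "(c S2 + \<epsilon>2) * S2 < R 1 + R 2 - r"
    by (rule margin[OF s(3,4)])
  have S01: "0 < S1" "0 < S2" using s S1 S2 by simp_all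
  have c1: "c S1 > 1" "c S2 > 1" using c S01 S1 S2 by (auto simp: overmeasuring_factor_def)
  define m where "m = (\<lambda>N. nat \<lceil>(c S1 + \<epsilon>1) * real (nat \<lfloor>S1 * real N\<rfloor>)\<rceil>)"
  define m2 where "m2 = (\<lambda>N. nat \<lceil>(c S2 + \<epsilon>2) * real (nat \<lfloor>S2 * real N\<rfloor>)\<rceil>)"
  have m: "(\<lambda>N. real (m N) / real N) \<longlonglongrightarrow> r"
    unfolding m_def r_def using c1 S1 S01 by (intro tendsto_rounded_rate) auto
  have m2: "(\<lambda>N. real (m2 N) / real N) \<longlonglongrightarrow> (c S2 + \<epsilon>2) * S2"
    unfolding m2_def using c1 S2 S01 by (intro tendsto_rounded_rate) auto
  have r: "0 \<le> r" "r \<le> R 1" "r \<le> R 2" using c1 S1 S01 by (auto simp: r_def)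
  define M where "M = (\<lambda>N j. max (m N) (nat \<lfloor>R j * real N\<rfloor>))"
  have M: "m N \<le> M N j" for N j by (simp add: M_def)
  have Mlim: "(\<lambda>N. real (M N j) / real N) \<longlonglongrightarrow> R j" if "j \<in> {1, 2}" for j
    unfolding M_def using that r by (intro tendsto_max_rows[OF m]) auto
  \<comment> \<open>The stacked matrix has row rate \<open>R 1 + R 2 - r\<close>, strictly above
    that of \<open>m2\<close>.\<close>
  have rows: "\<forall>\<^sub>F N in sequentially. m2 N \<le> M N 1 + (M N 2 - m N)"
  proof -
    have "(\<lambda>N. real (M N 1) / real N + (real (M N 2) / real N - real (m N) / real N)) \<longlonglongrightarrow> R 1 + (R 2 - r)"
      by (intro tendsto_intros Mlim m) auto
    from tendsto_diff[OF this m2]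
    have "\<forall>\<^sub>F N in sequentially. 0 < real (M N 1) / real N + (real (M N 2) / real N - real (m N) / real N)
        - real (m2 N) / real N"
      using S2(4) by (intro order_tendstoD(1)) auto
    then show ?thesis using eventually_gt_at_top[of 0]
    proof eventually_elim
      case (elim N)
      have "real (M N 1) / real N + (real (M N 2) / real N - real (m N) / real N) - real (m2 N) / real N
          = (real (M N 1) + (real (M N 2) - real (m N)) - real (m2 N)) / real N"
        by (simp add: add_divide_distrib diff_divide_distrib)
      then have "0 < real (M N 1) + (real (M N 2) - real (m N)) - real (m2 N)"
        using elim by (simp add: zero_less_divide_iff)
      \<comment> \<open>Subtraction of naturals agrees with that of reals because
        \<open>m N \<le> M N 2\<close>.\<close>
      then show ?case using M[of N 2] unfolding M_def m_def m2_def by linarith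
    qed
  qed
  define D where "D = (\<lambda>N. shared_rows_design N (m N) (M N))"
  define alg where "alg = (\<lambda>N. shared_rows_algorithm (m N) (M N))"
  define P where "P = (\<lambda>N. jsm1 S\<^sub>C (\<lambda>j. S\<^sub>I) \<sigma> N \<Otimes>\<^sub>M D N)"
  \<comment> \<open>The Chebyshev terms are kept apart from \<open>\<delta>\<close>: they vanish as
    \<open>N\<close> grows, whereas \<open>\<delta>\<close> is arbitrary but fixed.\<close>
  define e where "e = (\<lambda>N. 1 / (real N * (S1 - s\<^sub>1)\<^sup>2) + 1 / (real N * (S2 - s\<^sub>2)\<^sup>2))"
  have e: "e \<longlonglongrightarrow> 0"
  proof -
    have "(\<lambda>N. (1 / (S1 - s\<^sub>1)\<^sup>2) / real N + (1 / (S2 - s\<^sub>2)\<^sup>2) / real N) \<longlonglongrightarrow> 0 + 0"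
      by (intro tendsto_add lim_const_over_n)
    then show ?thesis by (simp add: e_def mult.commute)
  qed
  have bound: "\<forall>\<^sub>F N in sequentially. prob_space (P N) \<and>
      1 - (e N + 2 * \<delta>) \<le> measure (P N) (recovery_event N (M N) (alg N) \<inter> space (P N))"
    if \<delta>: "\<delta> > 0" for \<delta>
    using overmeasuring_factor_uniform[OF c S01(1) S1(2,3) \<delta>]
      overmeasuring_factor_uniform[OF c S01(2) S2(2,3) \<delta>] rows eventually_gt_at_top[of 0]
  proof eventually_elim
    case (elim N)
    have SC1: "S\<^sub>C \<le> 1" and SI1: "S\<^sub>I \<le> 1" using S\<^sub>C S\<^sub>I by simp_all
    have folds: "nat \<lceil>(c S1 + \<epsilon>1) * real (nat \<lfloor>S1 * real N\<rfloor>)\<rceil> = m N"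
      "nat \<lceil>(c S2 + \<epsilon>2) * real (nat \<lfloor>S2 * real N\<rfloor>)\<rceil> = m2 N" by (simp_all add: m_def m2_def)
    note prob = recovery_probability_shared_rows[where m = "m N" and M = "M N" and ?m1.0 = "m N" and ?m2.0 = "m2 N",
        OF \<sigma> S\<^sub>C(1) SC1 S\<^sub>I(1) SI1 elim(4) M M less_imp_le[OF \<delta>]
        S1(1)[unfolded s\<^sub>1_def] S1(2) S2(1)[unfolded s\<^sub>2_def] S2(2) order_refl
        elim(1)[unfolded folds, rule_format] elim(3) elim(2)[unfolded folds, rule_format]]
    show ?case
      using prob unfolding P_def D_def alg_def e_def s\<^sub>1_def s\<^sub>2_def by (rule conjI)
  qed
  have "(\<lambda>N. measure (P N) (recovery_event N (M N) (alg N) \<inter> space (P N))) \<longlonglongrightarrow> 1"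
  proof (rule order_tendstoI)
    fix a :: real assume "a < 1"
    \<comment> \<open>The loss is \<open>2 * \<delta>\<close> from failures on fixed signals plus
      \<open>e N\<close>, eventually below \<open>\<delta>\<close>; together less than
      \<open>4 * \<delta> = 1 - a\<close>.\<close>
    define \<delta> where "\<delta> = (1 - a) / 4"
    have \<delta>: "\<delta> > 0" using \<open>a < 1\<close> by (simp add: \<delta>_def)
    show "\<forall>\<^sub>F N in sequentially. a < measure (P N) (recovery_event N (M N) (alg N) \<inter> space (P N))"
      using bound[OF \<delta>] order_tendstoD(2)[OF e \<delta>]
    proof eventually_elim
      case (elim N)
      moreover have "a = 1 - 4 * \<delta>" by (simp add: \<delta>_def field_simps)
      ultimately show ?case using \<delta> by linarith
    qed
  next
    fix a :: real assume "1 < a"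
    show "\<forall>\<^sub>F N in sequentially. measure (P N) (recovery_event N (M N) (alg N) \<inter> space (P N)) < a"
      using bound[OF zero_less_one]
    proof eventually_elim
      case (elim N)
      then interpret prob_space "P N" by simp
      show ?case using \<open>1 < a\<close> by (meson le_less_trans prob_le_1)
    qed
  qed
  moreover have "gaussian_design N (M N) (D N)" for N
    unfolding D_def by (rule gaussian_design_shared_rows[where m = "m N" and M = "M N", OF M M])
  moreover have "length (steps (alg N)) = 2" for N by (simp add: alg_def shared_rows_algorithm_def)
  ultimately show "\<exists>M D alg T.
      (\<forall>j\<in>{1, 2}. (\<lambda>N. real (M N j) / real N) \<longlonglongrightarrow> R j) \<and>
      (\<forall>N. gaussian_design N (M N) (D N)) \<and> (\<forall>N. length (steps (alg N)) = T) \<and>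
      (\<lambda>N. measure (jsm1 S\<^sub>C (\<lambda>j. S\<^sub>I) \<sigma> N \<Otimes>\<^sub>M D N)
        (recovery_event N (M N) (alg N) \<inter> space (jsm1 S\<^sub>C (\<lambda>j. S\<^sub>I) \<sigma> N \<Otimes>\<^sub>M D N))) \<longlonglongrightarrow> 1"
    using Mlim unfolding P_def by blast
qed

end
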